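(* Let $A$ and $B$ be rings, let $(A,B,M,N,\psi,\varphi)$ be a Morita context, and let $T$ be the ring of this Morita context. If $\operatorname{im}(\psi)$ and $\operatorname{im}(\varphi)$ are nilpotent, then $A$ and $B$ are both strongly periodic if and only if $T$ is strongly periodic.
   Context: All rings are associative with identity. $P(R)$ is the prime radical of a ring $R$ (the intersection of all prime ideals). An element $p\in R$ is potent if $p=p^m$ for some integer $m\ge 2$. A ring $R$ is strongly periodic if for every $a\in R$ there exists a potent $p\in R$ such that $a-p\in P(R)$ and $ap=pa$. A Morita context $(A,B,M,N,\psi,\varphi)$ consists of two rings $A,B$, two bimodules ${}_AN_B$ and ${}_BM_A$, and bimodule homomorphisms $\psi:N\otimes_B M\to A$ and $\varphi:M\otimes_A N\to B$ satisfying $\psi(n\otimes m)n'=n\varphi(m\otimes n')$ and $\varphi(m\otimes n)m'=m\psi(n\otimes m')$ for all $m,m'\in M$, $n,n'\in N$. The ring of the Morita context is the set $T$ of generalized matrices $\begin{pmatrix}a&n\\ m&b\end{pmatrix}$ with $a\in A$, $b\in B$, $m\in M$, $n\in N$, with componentwise addition and multiplication $$\begin{pmatrix}a_1&n_1\\ m_1&b_1\end{pmatrix}\begin{pmatrix}a_2&n_2\\ m_2&b_2\end{pmatrix}=\begin{pmatrix}a_1a_2+\psi(n_1\otimes m_2)&a_1n_2+n_1b_2\\ m_1a_2+b_1m_2&\varphi(m_1\otimes n_2)+b_1b_2\end{pmatrix}.$$ The images $\operatorname{im}(\psi)$ and $\operatorname{im}(\varphi)$ are two-sided ideals of $A$ and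 $B$ respectively; an ideal $I$ is nilpotent if $I^k=0$ for some positive integer $k$. *)

theory Defs
  imports "HOL-Algebra.Free_Abelian_Groups" "HOL-Algebra.Ideal_Product" "HOL-Algebra.Module"
begin

section \<open>Prime radical and strongly periodic rings\<close>

text \<open>
  Rings are the (not necessarily commutative) unital rings of HOL-Algebra, and \<open>ideal\<close> means
  two-sided ideal. The library's \<open>primeideal\<close> presupposes a commutative ring, so the
  noncommutative notion is introduced here.
\<close>

definition nc_prime_ideal :: "'a set \<Rightarrow> ('a, 'r) ring_scheme \<Rightarrow> bool" where
  "nc_prime_ideal P R \<longleftrightarrow> ideal P R \<and> P \<noteq> carrier R \<and>
     (\<forall>I J. ideal I R \<longrightarrow> ideal J R \<longrightarrow> ideal_prod R I J \<subseteq> P \<longrightarrow> I \<subseteq> P \<or> J \<subseteq> P)"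

text \<open>
  The intersection is taken inside the carrier; this only matters for the zero ring, which has no
  prime ideals and is its own prime radical.
\<close>

definition prime_radical :: "('a, 'r) ring_scheme \<Rightarrow> 'a set" where
  "prime_radical R = carrier R \<inter> \<Inter> {P. nc_prime_ideal P R}"

definition potent :: "('a, 'r) ring_scheme \<Rightarrow> 'a \<Rightarrow> bool" where
  "potent R p \<longleftrightarrow> p \<in> carrier R \<and> (\<exists>m::nat. m \<ge> 2 \<and> p = p [^]\<^bsub>R\<^esub> m)"

definition strongly_periodic :: "('a, 'r) ring_scheme \<Rightarrow> bool" where
  "strongly_periodic R \<longleftrightarrow>
     (\<forall>a \<in> carrier R. \<exists>p. potent R p \<and> a \<ominus>\<^bsub>R\<^esub> p \<in> prime_radical R \<and>
        a \<otimes>\<^bsub>R\<^esub> p = p \<otimes>\<^bsub>R\<^esub> a)"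

text \<open>
  Powers are taken in \<open>ideals_set R\<close>, whose multiplication is the ideal product (finite sums of
  products) and whose unit is the ring itself.
\<close>

definition nilpotent_ideal :: "'a set \<Rightarrow> ('a, 'r) ring_scheme \<Rightarrow> bool" where
  "nilpotent_ideal I R \<longleftrightarrow>
     ideal I R \<and> (\<exists>k::nat. k > 0 \<and> I [^]\<^bsub>ideals_set R\<^esub> k = {\<zero>\<^bsub>R\<^esub>})"


section \<open>Bimodules\<close>

text \<open>
  As in the library's \<open>module\<close>, the ring fields \<open>mult\<close> and \<open>one\<close> of the record carry no meaning.
  The left action is the \<open>smult\<close> field. The library's locale \<open>module\<close> is not reused, since it
  requires a commutative ring of scalars.
\<close>

record ('a, 'b, 'm) bimodule = "('a, 'm) module" +
  rsmult :: "['m, 'b] \<Rightarrow> 'm" (infixl \<open>\<odot>\<^sub>r\<index>\<close> 70)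

locale bimodule = A: ring A + B: ring B + M: abelian_group M
  for A :: "('a, 'r) ring_scheme" and B :: "('b, 's) ring_scheme"
    and M :: "('a, 'b, 'm, 'e) bimodule_scheme" +
  assumes lsmult_closed: "\<lbrakk>a \<in> carrier A; x \<in> carrier M\<rbrakk> \<Longrightarrow> a \<odot>\<^bsub>M\<^esub> x \<in> carrier M"
    and lsmult_l_distr: "\<lbrakk>a \<in> carrier A; a' \<in> carrier A; x \<in> carrier M\<rbrakk> \<Longrightarrow>
      (a \<oplus>\<^bsub>A\<^esub> a') \<odot>\<^bsub>M\<^esub> x = a \<odot>\<^bsub>M\<^esub> x \<oplus>\<^bsub>M\<^esub> a' \<odot>\<^bsub>M\<^esub> x"
    and lsmult_r_distr: "\<lbrakk>a \<in> carrier A; x \<in> carrier M; y \<in> carrier M\<rbrakk> \<Longrightarrow>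
      a \<odot>\<^bsub>M\<^esub> (x \<oplus>\<^bsub>M\<^esub> y) = a \<odot>\<^bsub>M\<^esub> x \<oplus>\<^bsub>M\<^esub> a \<odot>\<^bsub>M\<^esub> y"
    and lsmult_assoc: "\<lbrakk>a \<in> carrier A; a' \<in> carrier A; x \<in> carrier M\<rbrakk> \<Longrightarrow>
      (a \<otimes>\<^bsub>A\<^esub> a') \<odot>\<^bsub>M\<^esub> x = a \<odot>\<^bsub>M\<^esub> (a' \<odot>\<^bsub>M\<^esub> x)"
    and lsmult_one: "x \<in> carrier M \<Longrightarrow> \<one>\<^bsub>A\<^esub> \<odot>\<^bsub>M\<^esub> x = x"
    and rsmult_closed: "\<lbrakk>x \<in> carrier M; b \<in> carrier B\<rbrakk> \<Longrightarrow> x \<odot>\<^sub>r\<^bsub>M\<^esub> b \<in> carrier M"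
    and rsmult_r_distr: "\<lbrakk>x \<in> carrier M; b \<in> carrier B; b' \<in> carrier B\<rbrakk> \<Longrightarrow>
      x \<odot>\<^sub>r\<^bsub>M\<^esub> (b \<oplus>\<^bsub>B\<^esub> b') = x \<odot>\<^sub>r\<^bsub>M\<^esub> b \<oplus>\<^bsub>M\<^esub> x \<odot>\<^sub>r\<^bsub>M\<^esub> b'"
    and rsmult_l_distr: "\<lbrakk>x \<in> carrier M; y \<in> carrier M; b \<in> carrier B\<rbrakk> \<Longrightarrow>
      (x \<oplus>\<^bsub>M\<^esub> y) \<odot>\<^sub>r\<^bsub>M\<^esub> b = x \<odot>\<^sub>r\<^bsub>M\<^esub> b \<oplus>\<^bsub>M\<^esub> y \<odot>\<^sub>r\<^bsub>M\<^esub> b"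
    and rsmult_assoc: "\<lbrakk>x \<in> carrier M; b \<in> carrier B; b' \<in> carrier B\<rbrakk> \<Longrightarrow>
      x \<odot>\<^sub>r\<^bsub>M\<^esub> (b \<otimes>\<^bsub>B\<^esub> b') = (x \<odot>\<^sub>r\<^bsub>M\<^esub> b) \<odot>\<^sub>r\<^bsub>M\<^esub> b'"
    and rsmult_one: "x \<in> carrier M \<Longrightarrow> x \<odot>\<^sub>r\<^bsub>M\<^esub> \<one>\<^bsub>B\<^esub> = x"
    and smult_rsmult_assoc: "\<lbrakk>a \<in> carrier A; x \<in> carrier M; b \<in> carrier B\<rbrakk> \<Longrightarrow>
      (a \<odot>\<^bsub>M\<^esub> x) \<odot>\<^sub>r\<^bsub>M\<^esub> b = a \<odot>\<^bsub>M\<^esub> (x \<odot>\<^sub>r\<^bsub>M\<^esub> b)"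

definition regular_bimodule :: "('a, 'r) ring_scheme \<Rightarrow> ('a, 'a, 'a) bimodule" where
  "regular_bimodule R =
     \<lparr>carrier = carrier R, mult = mult R, one = \<one>\<^bsub>R\<^esub>,
      zero = \<zero>\<^bsub>R\<^esub>, add = add R,
      smult = mult R, rsmult = mult R\<rparr>"

definition bimodule_hom ::
  "('a, 'r) ring_scheme \<Rightarrow> ('b, 's) ring_scheme \<Rightarrow> ('a, 'b, 'm, 'e) bimodule_scheme \<Rightarrow>
   ('a, 'b, 'n, 'f) bimodule_scheme \<Rightarrow> ('m \<Rightarrow> 'n) set" where
  "bimodule_hom A B X Y =
     {f. f \<in> carrier X \<rightarrow> carrier Y \<and>
         (\<forall>x \<in> carrier X. \<forall>y \<in> carrier X. f (x \<oplus>\<^bsub>X\<^esub> y) = f x \<oplus>\<^bsub>Y\<^esub> f y) \<and>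
         (\<forall>a \<in> carrier A. \<forall>x \<in> carrier X. f (a \<odot>\<^bsub>X\<^esub> x) = a \<odot>\<^bsub>Y\<^esub> f x) \<and>
         (\<forall>x \<in> carrier X. \<forall>b \<in> carrier B. f (x \<odot>\<^sub>r\<^bsub>X\<^esub> b) = f x \<odot>\<^sub>r\<^bsub>Y\<^esub> b)}"


section \<open>Tensor products of bimodules\<close>

text \<open>
  For an \<open>A\<close>-\<open>B\<close>-bimodule \<open>X\<close> and a \<open>B\<close>-\<open>C\<close>-bimodule \<open>Y\<close>, the tensor product over \<open>B\<close> is the free
  abelian group on \<open>X \<times> Y\<close> modulo the subgroup generated by the usual relators.
\<close>

abbreviation tensor_free ::
  "('a, 'b, 'x, 'e) bimodule_scheme \<Rightarrow> ('b, 'c, 'y, 'f) bimodule_scheme \<Rightarrow>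
   ('x \<times> 'y \<Rightarrow>\<^sub>0 int) monoid" where
  "tensor_free X Y \<equiv> free_Abelian_group (carrier X \<times> carrier Y)"

definition tensor_relators ::
  "('b, 's) ring_scheme \<Rightarrow> ('a, 'b, 'x, 'e) bimodule_scheme \<Rightarrow>
   ('b, 'c, 'y, 'f) bimodule_scheme \<Rightarrow> ('x \<times> 'y \<Rightarrow>\<^sub>0 int) set" where
  "tensor_relators B X Y =
     {frag_of (x \<oplus>\<^bsub>X\<^esub> x', y) - frag_of (x, y) - frag_of (x', y) | x x' y.
        x \<in> carrier X \<and> x' \<in> carrier X \<and> y \<in> carrier Y} \<union>
     {frag_of (x, y \<oplus>\<^bsub>Y\<^esub> y') - frag_of (x, y) - frag_of (x, y') | x y y'.
        x \<in> carrier X \<and> y \<in> carrier Y \<and> y' \<in> carrier Y} \<union>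
     {frag_of (x \<odot>\<^sub>r\<^bsub>X\<^esub> b, y) - frag_of (x, b \<odot>\<^bsub>Y\<^esub> y) | x b y.
        x \<in> carrier X \<and> b \<in> carrier B \<and> y \<in> carrier Y}"

definition tensor_rel ::
  "('b, 's) ring_scheme \<Rightarrow> ('a, 'b, 'x, 'e) bimodule_scheme \<Rightarrow>
   ('b, 'c, 'y, 'f) bimodule_scheme \<Rightarrow> ('x \<times> 'y \<Rightarrow>\<^sub>0 int) set" where
  "tensor_rel B X Y = generate (tensor_free X Y) (tensor_relators B X Y)"

definition pure_tensor ::
  "('b, 's) ring_scheme \<Rightarrow> ('a, 'b, 'x, 'e) bimodule_scheme \<Rightarrow>
   ('b, 'c, 'y, 'f) bimodule_scheme \<Rightarrow> 'x \<Rightarrow> 'y \<Rightarrow> ('x \<times> 'y \<Rightarrow>\<^sub>0 int) set" where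
  "pure_tensor B X Y x y = tensor_rel B X Y #>\<^bsub>tensor_free X Y\<^esub> frag_of (x, y)"

text \<open>
  The actions are those induced by \<open>a(x \<otimes> y) = ax \<otimes> y\<close> and \<open>(x \<otimes> y)c = x \<otimes> yc\<close>: the additive
  extension to the free group is applied to a coset elementwise, and adding the relation subgroup
  turns the result into a coset again. The meaningless ring multiplication and unit are left
  undefined.
\<close>

definition tensor_bimodule ::
  "('b, 's) ring_scheme \<Rightarrow> ('a, 'b, 'x, 'e) bimodule_scheme \<Rightarrow>
   ('b, 'c, 'y, 'f) bimodule_scheme \<Rightarrow> ('a, 'c, ('x \<times> 'y \<Rightarrow>\<^sub>0 int) set) bimodule" where
  "tensor_bimodule B X Y =
     \<lparr>carrier = carrier (tensor_free X Y Mod tensor_rel B X Y),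
      mult = undefined,
      one = undefined,
      zero = \<one>\<^bsub>tensor_free X Y Mod tensor_rel B X Y\<^esub>,
      add = mult (tensor_free X Y Mod tensor_rel B X Y),
      smult = (\<lambda>a t. tensor_rel B X Y <#>\<^bsub>tensor_free X Y\<^esub>
                       (frag_extend (\<lambda>(x, y). frag_of (a \<odot>\<^bsub>X\<^esub> x, y)) ` t)),
      rsmult = (\<lambda>t c. tensor_rel B X Y <#>\<^bsub>tensor_free X Y\<^esub>
                       (frag_extend (\<lambda>(x, y). frag_of (x, y \<odot>\<^sub>r\<^bsub>Y\<^esub> c)) ` t))\<rparr>"


section \<open>Morita contexts\<close>

locale morita_context = N: bimodule A B N + M: bimodule B A M
  for A :: "('a, 'r) ring_scheme" and B :: "('b, 's) ring_scheme"
    and M :: "('b, 'a, 'm, 'e) bimodule_scheme" and N :: "('a, 'b, 'n, 'f) bimodule_scheme"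
    and \<psi> :: "('n \<times> 'm \<Rightarrow>\<^sub>0 int) set \<Rightarrow> 'a" and \<phi> :: "('m \<times> 'n \<Rightarrow>\<^sub>0 int) set \<Rightarrow> 'b" +
  assumes psi_hom: "\<psi> \<in> bimodule_hom A A (tensor_bimodule B N M) (regular_bimodule A)"
    and phi_hom: "\<phi> \<in> bimodule_hom B B (tensor_bimodule A M N) (regular_bimodule B)"
    and psi_phi: "\<lbrakk>n \<in> carrier N; m \<in> carrier M; n' \<in> carrier N\<rbrakk> \<Longrightarrow>
      \<psi> (pure_tensor B N M n m) \<odot>\<^bsub>N\<^esub> n' = n \<odot>\<^sub>r\<^bsub>N\<^esub> \<phi> (pure_tensor A M N m n')"
    and phi_psi: "\<lbrakk>m \<in> carrier M; n \<in> carrier N; m' \<in> carrier M\<rbrakk> \<Longrightarrow>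
      \<phi> (pure_tensor A M N m n) \<odot>\<^bsub>M\<^esub> m' = m \<odot>\<^sub>r\<^bsub>M\<^esub> \<psi> (pure_tensor B N M n m')"

text \<open>
  A tuple \<open>(a, n, m, b)\<close> stands for the generalized matrix with first row \<open>a, n\<close> and second row
  \<open>m, b\<close>.
\<close>

definition morita_ring ::
  "('a, 'r) ring_scheme \<Rightarrow> ('b, 's) ring_scheme \<Rightarrow>
   ('b, 'a, 'm, 'e) bimodule_scheme \<Rightarrow> ('a, 'b, 'n, 'f) bimodule_scheme \<Rightarrow>
   (('n \<times> 'm \<Rightarrow>\<^sub>0 int) set \<Rightarrow> 'a) \<Rightarrow> (('m \<times> 'n \<Rightarrow>\<^sub>0 int) set \<Rightarrow> 'b) \<Rightarrow>
   ('a \<times> 'n \<times> 'm \<times> 'b) ring" where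
  "morita_ring A B M N \<psi> \<phi> =
     \<lparr>carrier = carrier A \<times> carrier N \<times> carrier M \<times> carrier B,
      mult = (\<lambda>(a\<^sub>1, n\<^sub>1, m\<^sub>1, b\<^sub>1) (a\<^sub>2, n\<^sub>2, m\<^sub>2, b\<^sub>2).
        (a\<^sub>1 \<otimes>\<^bsub>A\<^esub> a\<^sub>2 \<oplus>\<^bsub>A\<^esub> \<psi> (pure_tensor B N M n\<^sub>1 m\<^sub>2),
         a\<^sub>1 \<odot>\<^bsub>N\<^esub> n\<^sub>2 \<oplus>\<^bsub>N\<^esub> n\<^sub>1 \<odot>\<^sub>r\<^bsub>N\<^esub> b\<^sub>2,
         m\<^sub>1 \<odot>\<^sub>r\<^bsub>M\<^esub> a\<^sub>2 \<oplus>\<^bsub>M\<^esub> b\<^sub>1 \<odot>\<^bsub>M\<^esub> m\<^sub>2,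
         \<phi> (pure_tensor A M N m\<^sub>1 n\<^sub>2) \<oplus>\<^bsub>B\<^esub> b\<^sub>1 \<otimes>\<^bsub>B\<^esub> b\<^sub>2)),
      one = (\<one>\<^bsub>A\<^esub>, \<zero>\<^bsub>N\<^esub>, \<zero>\<^bsub>M\<^esub>, \<one>\<^bsub>B\<^esub>),
      zero = (\<zero>\<^bsub>A\<^esub>, \<zero>\<^bsub>N\<^esub>, \<zero>\<^bsub>M\<^esub>, \<zero>\<^bsub>B\<^esub>),
      add = (\<lambda>(a\<^sub>1, n\<^sub>1, m\<^sub>1, b\<^sub>1) (a\<^sub>2, n\<^sub>2, m\<^sub>2, b\<^sub>2).
        (a\<^sub>1 \<oplus>\<^bsub>A\<^esub> a\<^sub>2, n\<^sub>1 \<oplus>\<^bsub>N\<^esub> n\<^sub>2, m\<^sub>1 \<oplus>\<^bsub>M\<^esub> m\<^sub>2, b\<^sub>1 \<oplus>\<^bsub>B\<^esub> b\<^sub>2))\<rparr>"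

end

theory Submission
  imports Defs "HOL-Algebra.Subrings"
begin

text \<open>
  Because \<open>P(R)\<close> is nil, strong periodicity of \<open>R\<close> amounts to the condition that every \<open>a\<close>
  satisfies \<open>a - a\<^sup>n \<in> P(R)\<close> for some \<open>n \<ge> 2\<close>. For the nontrivial direction, \<open>a = 2\<close> shows that
  such a ring has positive characteristic \<open>c\<close>; in the commutative bicommutant of \<open>a\<close>, raising
  \<open>x = y + w z\<close> to the power \<open>c\<close> replaces \<open>w\<close> by \<open>w\<^sup>2\<close>, so iteration kills the nilpotent
  \<open>a - a\<^sup>n\<close>. Hence high powers of \<open>a\<close> are potent, and one of them is congruent to \<open>a\<close>.

  For the Morita ring \<open>T\<close>, the images of \<open>\<psi>\<close> and \<open>\<phi>\<close> lie in the prime radicals, so the diagonal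
  projections are multiplicative modulo the radical, and a matrix with diagonal entries in the
  radicals lies in \<open>P(T)\<close>. The elementwise criterion therefore passes between \<open>T\<close> and its diagonal,
  using a common exponent for \<open>A\<close> and \<open>B\<close>.
\<close>

section \<open>The prime radical\<close>

context ring
begin

lemma idealI_diff:
  assumes "I \<subseteq> carrier R" "\<zero> \<in> I"
    and "\<And>x y. \<lbrakk>x \<in> I; y \<in> I\<rbrakk> \<Longrightarrow> x \<ominus> y \<in> I"
    and "\<And>x r. \<lbrakk>x \<in> I; r \<in> carrier R\<rbrakk> \<Longrightarrow> r \<otimes> x \<in> I"
    and "\<And>x r. \<lbrakk>x \<in> I; r \<in> carrier R\<rbrakk> \<Longrightarrow> x \<otimes> r \<in> I"
  shows "ideal I R"
proof (rule idealI[OF ring_axioms])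
  have neg: "\<ominus> x \<in> I" if "x \<in> I" for x
    using assms(3)[OF assms(2) that] that assms(1) by (auto simp: minus_eq)
  show "subgroup I (add_monoid R)"
  proof (rule add.subgroupI)
    show "x \<oplus> y \<in> I" if "x \<in> I" "y \<in> I" for x y
      using assms(3)[OF that(1) neg[OF that(2)]] that assms(1) by (auto simp: minus_eq)
  qed (use assms neg in \<open>auto simp: a_inv_def\<close>)
qed (use assms in auto)

lemma ideal_minus_closed: "\<lbrakk>ideal I R; x \<in> I; y \<in> I\<rbrakk> \<Longrightarrow> x \<ominus> y \<in> I"
  unfolding minus_eq
  by (meson additive_subgroup.a_closed additive_subgroup.a_inv_closed ideal.axioms(1))

lemma ideal_plus_closed: "\<lbrakk>ideal I R; x \<in> I; y \<in> I\<rbrakk> \<Longrightarrow> x \<oplus> y \<in> I"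
  by (meson additive_subgroup.a_closed ideal.axioms(1))

lemma ideal_zero_closed: "ideal I R \<Longrightarrow> \<zero> \<in> I"
  by (meson additive_subgroup.zero_closed ideal.axioms(1))

lemma ideal_prod_subset:
  assumes "ideal P R" "\<And>i j. \<lbrakk>i \<in> I; j \<in> J\<rbrakk> \<Longrightarrow> i \<otimes> j \<in> P"
  shows "ideal_prod R I J \<subseteq> P"
proof
  fix s assume "s \<in> ideal_prod R I J"
  then show "s \<in> P"
    by (induct rule: ideal_prod.induct) (use assms ideal_plus_closed in auto)
qed

text \<open>Primeness speaks about pairs of ideals, so \<open>x\<close> and \<open>y\<close> are
  placed in ideals \<open>J\<close> and \<open>K\<close> whose product still lies in
  \<open>P\<close>.\<close>

lemma nc_prime_ideal_memD:
  assumes P: "nc_prime_ideal P R" and x: "x \<in> carrier R" and y: "y \<in> carrier R"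
    and xy: "\<And>r. r \<in> carrier R \<Longrightarrow> x \<otimes> r \<otimes> y \<in> P"
  shows "x \<in> P \<or> y \<in> P"
proof -
  have I: "ideal P R" using P by (simp add: nc_prime_ideal_def)
  interpret I: ideal P R by fact
  \<comment> \<open>\<open>J\<close> and \<open>K\<close> are annihilators modulo \<open>P\<close>,
    not the ideals generated by \<open>x\<close> and \<open>y\<close>; this avoids handling elements
    of generated ideals as finite sums.\<close>
  define J where "J = {z \<in> carrier R. \<forall>r \<in> carrier R. z \<otimes> r \<otimes> y \<in> P}"
  define K where "K = {z \<in> carrier R. \<forall>j \<in> J. \<forall>r \<in> carrier R. j \<otimes> r \<otimes> z \<in> P}"
  have J: "ideal J R"
  proof (rule idealI_diff)
    show "a \<ominus> b \<in> J" if "a \<in> J" "b \<in> J" for a b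
      using that y ideal_minus_closed[OF I]
      by (auto simp: J_def minus_eq l_distr l_minus)
    show "s \<otimes> a \<in> J" if "a \<in> J" "s \<in> carrier R" for a s
      using that y I.I_l_closed by (auto simp: J_def m_assoc)
    show "a \<otimes> s \<in> J" if "a \<in> J" "s \<in> carrier R" for a s
      using that y by (auto simp: J_def m_assoc) (metis m_assoc m_closed)
  qed (use y I.zero_closed in \<open>auto simp: J_def\<close>)
  have Jc: "J \<subseteq> carrier R" by (auto simp: J_def)
  have K: "ideal K R"
  proof (rule idealI_diff)
    show "a \<ominus> b \<in> K" if "a \<in> K" "b \<in> K" for a b
    proof -
      have "j \<otimes> r \<otimes> (a \<ominus> b) = j \<otimes> r \<otimes> a \<ominus> j \<otimes> r \<otimes> b" if "j \<in> J" "r \<in> carrier R" for j r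
        using that \<open>a \<in> K\<close> \<open>b \<in> K\<close> Jc by (auto simp: K_def minus_eq r_distr r_minus)
      then show ?thesis using that ideal_minus_closed[OF I] by (auto simp: K_def)
    qed
    show "s \<otimes> a \<in> K" if "a \<in> K" "s \<in> carrier R" for a s
    proof -
      have "j \<otimes> r \<otimes> (s \<otimes> a) = j \<otimes> (r \<otimes> s) \<otimes> a" if "j \<in> J" "r \<in> carrier R" for j r
        using that \<open>a \<in> K\<close> \<open>s \<in> carrier R\<close> Jc by (auto simp: K_def m_assoc subsetD)
      then show ?thesis using that by (auto simp: K_def)
    qed
    show "a \<otimes> s \<in> K" if "a \<in> K" "s \<in> carrier R" for a s
    proof -
      have "j \<otimes> r \<otimes> (a \<otimes> s) = j \<otimes> r \<otimes> a \<otimes> s" if "j \<in> J" "r \<in> carrier R" for j r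
        using that \<open>a \<in> K\<close> \<open>s \<in> carrier R\<close> Jc by (auto simp: K_def m_assoc subsetD)
      then show ?thesis using that I.I_r_closed by (auto simp: K_def)
    qed
  qed (use Jc I.zero_closed in \<open>auto simp: K_def subsetD\<close>)
  have "ideal_prod R J K \<subseteq> P"
  proof (rule ideal_prod_subset[OF I])
    fix j k assume "j \<in> J" "k \<in> K"
    \<comment> \<open>The middle factor \<open>\<one>\<close> turns the condition defining
      \<open>K\<close> into one on plain products.\<close>
    then have "j \<otimes> \<one> \<otimes> k \<in> P" by (auto simp: K_def)
    then show "j \<otimes> k \<in> P" using \<open>j \<in> J\<close> Jc by auto
  qed
  then have "J \<subseteq> P \<or> K \<subseteq> P" using P J K by (simp add: nc_prime_ideal_def)
  moreover have "x \<in> J" "y \<in> K" using x y xy by (auto simp: J_def K_def)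
  ultimately show ?thesis by auto
qed

text \<open>If \<open>x \<in> I\<close> and \<open>y \<in> J\<close> both lay outside
  \<open>P\<close>, every \<open>x r y\<close> would still lie in the product of \<open>I\<close>
  and \<open>J\<close>, hence in \<open>P\<close>, contradicting \<open>mem\<close>. Preimages of
  prime ideals are shown to be prime in this form.\<close>

lemma nc_prime_idealI:
  assumes "ideal P R" "P \<noteq> carrier R"
    and mem: "\<And>x y. \<lbrakk>x \<in> carrier R; y \<in> carrier R; \<forall>r \<in> carrier R. x \<otimes> r \<otimes> y \<in> P\<rbrakk> \<Longrightarrow> x \<in> P \<or> y \<in> P"
  shows "nc_prime_ideal P R"
  unfolding nc_prime_ideal_def
proof (intro conjI allI impI)
  fix I J assume IJ: "ideal I R" "ideal J R" "ideal_prod R I J \<subseteq> P"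
  show "I \<subseteq> P \<or> J \<subseteq> P"
  proof (rule ccontr)
    assume "\<not> ?thesis"
    then obtain x y where xy: "x \<in> I" "x \<notin> P" "y \<in> J" "y \<notin> P" by auto
    have "\<forall>r \<in> carrier R. x \<otimes> r \<otimes> y \<in> P"
      using IJ xy ideal.I_r_closed[OF IJ(1)] ideal_prod.prod[of _ I y J R] by blast
    then show False using mem[of x y] xy IJ by (meson ideal.Icarr)
  qed
qed (use assms in auto)

lemma prime_radical_ideal: "ideal (prime_radical R) R"
proof -
  have id: "ideal P R" if "nc_prime_ideal P R" for P using that by (simp add: nc_prime_ideal_def)
  show ?thesis
  proof (rule idealI_diff)
    show "x \<ominus> y \<in> prime_radical R" if "x \<in> prime_radical R" "y \<in> prime_radical R" for x y
      using that by (auto simp: prime_radical_def intro: ideal_minus_closed[OF id])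
  qed (auto simp: prime_radical_def intro: ideal_zero_closed[OF id]
        ideal.I_l_closed[OF id] ideal.I_r_closed[OF id])
qed

lemma prime_radicalI:
  "\<lbrakk>x \<in> carrier R; \<And>P. nc_prime_ideal P R \<Longrightarrow> x \<in> P\<rbrakk> \<Longrightarrow> x \<in> prime_radical R"
  by (auto simp: prime_radical_def)

lemma prime_radicalD: "\<lbrakk>x \<in> prime_radical R; nc_prime_ideal P R\<rbrakk> \<Longrightarrow> x \<in> P"
  by (auto simp: prime_radical_def)

text \<open>Primeness removes one factor \<open>I\<close> at a time from any power of
  \<open>I\<close> contained in \<open>P\<close>, and the zero ideal is such a power.\<close>

lemma nilpotent_ideal_subset_prime:
  assumes "nilpotent_ideal I R" "nc_prime_ideal P R"
  shows "I \<subseteq> P"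
proof -
  have I: "ideal I R" and P: "ideal P R" "P \<noteq> carrier R"
    using assms by (auto simp: nilpotent_ideal_def nc_prime_ideal_def)
  obtain k :: nat where k: "I [^]\<^bsub>ideals_set R\<^esub> k = {\<zero>}"
    using assms by (auto simp: nilpotent_ideal_def)
  have "ideal (I [^]\<^bsub>ideals_set R\<^esub> j) R \<and> (I [^]\<^bsub>ideals_set R\<^esub> j \<subseteq> P \<longrightarrow> I \<subseteq> P)" for j :: nat
  proof (induct j)
    case 0
    \<comment> \<open>The zeroth power is the whole ring, which a proper ideal cannot contain, so
      the induction starts vacuously.\<close>
    have "carrier R \<subseteq> P \<Longrightarrow> P = carrier R" using P(1) by (auto dest: ideal.Icarr)
    then show ?case using P by (auto simp: ideals_set_def oneideal)
  next
    case (Suc j)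
    have eq: "I [^]\<^bsub>ideals_set R\<^esub> Suc j = ideal_prod R (I [^]\<^bsub>ideals_set R\<^esub> j) I"
      by (simp add: ideals_set_def)
    have "ideal_prod R (I [^]\<^bsub>ideals_set R\<^esub> j) I \<subseteq> P \<Longrightarrow> I [^]\<^bsub>ideals_set R\<^esub> j \<subseteq> P \<or> I \<subseteq> P"
      using Suc I assms(2) unfolding nc_prime_ideal_def by blast
    then show ?case unfolding eq
      using Suc I ideal_prod_is_ideal by blast
  qed
  from this[of k] show ?thesis using ideal_zero_closed[OF P(1)] by (auto simp: k)
qed

lemma nilpotent_ideal_subset_prime_radical:
  assumes "nilpotent_ideal I R" shows "I \<subseteq> prime_radical R"
proof
  fix x assume x: "x \<in> I"
  have "ideal I R" using assms by (simp add: nilpotent_ideal_def)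
  then show "x \<in> prime_radical R"
    using x nilpotent_ideal_subset_prime[OF assms]
    by (intro prime_radicalI) (auto dest: ideal.Icarr)
qed

section \<open>Zorn's lemma and the nilpotency of elements of the prime radical\<close>

lemma chain_Union_ideal:
  assumes "C \<noteq> {}" "\<And>I. I \<in> C \<Longrightarrow> ideal I R" "\<And>I J. \<lbrakk>I \<in> C; J \<in> C\<rbrakk> \<Longrightarrow> I \<subseteq> J \<or> J \<subseteq> I"
  shows "ideal (\<Union>C) R"
proof (rule idealI_diff)
  show "\<Union>C \<subseteq> carrier R" using ideal.Icarr[OF assms(2)] by auto
  show "\<zero> \<in> \<Union>C" using assms(1) ideal_zero_closed[OF assms(2)] by auto
  fix x y assume "x \<in> \<Union>C" "y \<in> \<Union>C"
  then obtain I J where "x \<in> I" "I \<in> C" "y \<in> J" "J \<in> C" by auto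
  then obtain K where K: "K \<in> C" "x \<in> K" "y \<in> K" using assms(3)[of I J] by auto
  show "x \<ominus> y \<in> \<Union>C" using ideal_minus_closed[OF assms(2)[OF K(1)] K(2,3)] K(1) by auto
next
  fix x r assume "x \<in> \<Union>C" and r: "r \<in> carrier R"
  then obtain I where I: "I \<in> C" "x \<in> I" by auto
  show "r \<otimes> x \<in> \<Union>C"
    using ideal.I_l_closed[OF assms(2)[OF I(1)] I(2) r] I(1) by (rule UnionI[rotated])
  show "x \<otimes> r \<in> \<Union>C"
    using ideal.I_r_closed[OF assms(2)[OF I(1)] I(2) r] I(1) by (rule UnionI[rotated])
qed

text \<open>An ideal maximal among those avoiding the powers of an element is prime.\<close>

lemma prime_radical_nil:
  assumes a: "a \<in> prime_radical R"
  shows "\<exists>k::nat. a [^] k = \<zero>"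
proof (rule ccontr)
  assume nz: "\<not> ?thesis"
  have ac: "a \<in> carrier R" using a by (auto simp: prime_radical_def)
  define F where "F = {I. ideal I R \<and> (\<forall>k::nat. a [^] k \<notin> I)}"
  have "\<exists>P\<in>F. \<forall>I\<in>F. P \<subseteq> I \<longrightarrow> I = P"
  proof (rule subset_Zorn)
    fix C assume C: "subset.chain F C"
    have CF: "C \<subseteq> F" and lin: "\<And>I J. \<lbrakk>I \<in> C; J \<in> C\<rbrakk> \<Longrightarrow> I \<subseteq> J \<or> J \<subseteq> I"
      using C by (auto simp: subset_chain_def)
    show "\<exists>U\<in>F. \<forall>X\<in>C. X \<subseteq> U"
    proof (cases "C = {}")
      case True
      \<comment> \<open>The zero ideal bounds the empty chain; it belongs to \<open>F\<close>
        because \<open>a\<close> is assumed not to be nilpotent.\<close>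
      have "{\<zero>} \<in> F" using nz zeroideal by (auto simp: F_def)
      then show ?thesis using True by auto
    next
      case False
      have "ideal (\<Union>C) R" using chain_Union_ideal[OF False _ lin] CF by (auto simp: F_def)
      then have "\<Union>C \<in> F" using CF by (auto simp: F_def)
      then show ?thesis by blast
    qed
  qed
  then obtain P where PF: "P \<in> F" and max: "\<And>I. \<lbrakk>I \<in> F; P \<subseteq> I\<rbrakk> \<Longrightarrow> I = P" by auto
  have P: "ideal P R" and Pa: "\<And>k::nat. a [^] k \<notin> P" using PF by (auto simp: F_def)
  interpret P: ideal P R by fact
  \<comment> \<open>If \<open>I\<close> is not inside \<open>P\<close>, then \<open>P + I\<close> is
    strictly larger than \<open>P\<close>, so by maximality it falls outside \<open>F\<close> and
    contains a power of \<open>a\<close>.\<close>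
  have pow: "\<exists>k::nat. \<exists>p\<in>P. \<exists>i\<in>I. a [^] k = p \<oplus> i" if I: "ideal I R" "\<not> I \<subseteq> P" for I
  proof (rule ccontr)
    assume no: "\<not> ?thesis"
    have "ideal (P <+>\<^bsub>R\<^esub> I) R" by (rule add_ideals[OF P I(1)])
    then have "P <+>\<^bsub>R\<^esub> I \<in> F" using no by (auto simp: F_def set_add_def')
    moreover have "P \<subseteq> P <+>\<^bsub>R\<^esub> I" "I \<subseteq> P <+>\<^bsub>R\<^esub> I"
    proof -
      have "p \<oplus> \<zero> \<in> P <+>\<^bsub>R\<^esub> I" if "p \<in> P" for p
        using that ideal_zero_closed[OF I(1)] unfolding set_add_def' by blast
      then show "P \<subseteq> P <+>\<^bsub>R\<^esub> I" by (auto simp: P.Icarr)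
      have "\<zero> \<oplus> i \<in> P <+>\<^bsub>R\<^esub> I" if "i \<in> I" for i
        using that P.zero_closed unfolding set_add_def' by blast
      then show "I \<subseteq> P <+>\<^bsub>R\<^esub> I" by (auto simp: ideal.Icarr[OF I(1)])
    qed
    ultimately show False using max I(2) by blast
  qed
  have "nc_prime_ideal P R" unfolding nc_prime_ideal_def
  proof (intro conjI allI impI)
    \<comment> \<open>The zeroth power of \<open>a\<close> is \<open>\<one>\<close>, so
      \<open>P\<close> misses \<open>\<one>\<close>.\<close>
    show "P \<noteq> carrier R" using Pa[of 0] by auto
    fix I J assume IJ: "ideal I R" "ideal J R" "ideal_prod R I J \<subseteq> P"
    show "I \<subseteq> P \<or> J \<subseteq> P"
    proof (rule ccontr)
      assume "\<not> ?thesis"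
      then obtain k l :: nat and p i q j where
        k: "p \<in> P" "i \<in> I" "a [^] k = p \<oplus> i" and l: "q \<in> P" "j \<in> J" "a [^] l = q \<oplus> j"
        using pow[OF IJ(1)] pow[OF IJ(2)] by blast
      have c: "p \<in> carrier R" "i \<in> carrier R" "q \<in> carrier R" "j \<in> carrier R"
        using k l P.Icarr ideal.Icarr[OF IJ(1)] ideal.Icarr[OF IJ(2)] by auto
      \<comment> \<open>In the expanded product every term has a factor in \<open>P\<close> except
        \<open>i \<otimes> j\<close>, which lies in the product of \<open>I\<close> and
        \<open>J\<close>; so a power of \<open>a\<close> would land in \<open>P\<close>.\<close>
      have "a [^] (k + l) = (p \<oplus> i) \<otimes> (q \<oplus> j)"
        using ac k l by (simp add: nat_pow_mult[symmetric])
      also have "\<dots> = p \<otimes> (q \<oplus> j) \<oplus> (i \<otimes> q \<oplus> i \<otimes> j)"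
        using c by (simp add: l_distr[of p i] r_distr[of q j i])
      also have "\<dots> \<in> P"
      proof (intro ideal_plus_closed[OF P])
        show "p \<otimes> (q \<oplus> j) \<in> P" "i \<otimes> q \<in> P"
          using c k(1) l(1) by (simp_all add: P.I_l_closed P.I_r_closed)
        show "i \<otimes> j \<in> P" using k(2) l(2) IJ(3) ideal_prod.prod[of i I j J R] by auto
      qed
      finally show False using Pa by blast
    qed
  qed (rule P)
  then have "a \<in> P" using a prime_radicalD by blast
  then show False using Pa[of 1] ac by simp
qed

end

section \<open>An elementwise criterion for strong periodicity\<close>

lemma (in ring) add_pow_one_mult:
  "add_pow R (m::nat) \<one> \<otimes> (add_pow R (n::nat) \<one>) = add_pow R (m * n) \<one>"
  by (simp add: add_pow_ldistr add.nat_pow_pow mult.commute)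

lemma (in ring) add_pow_one_pow:
  "(add_pow R (m::nat) \<one>) [^] (k::nat) = add_pow R (m ^ k) \<one>"
  by (induct k) (simp_all add: add_pow_one_mult mult.commute)

section \<open>Powers of sums in commutative rings of positive characteristic\<close>

context cring
begin

text \<open>This is the binomial theorem to first order in \<open>w\<close>, with all higher terms
  collected in \<open>s\<close>. The point is the coefficient of the linear term: it equals the
  exponent and vanishes as soon as the exponent is zero in the ring.\<close>

lemma pow_Suc_add_mult:
  assumes "y \<in> carrier R" "w \<in> carrier R" "z \<in> carrier R"
  shows "\<exists>s\<in>carrier R. (y \<oplus> w \<otimes> z) [^] Suc k =
           y [^] Suc k \<oplus> add_pow R (Suc k) \<one> \<otimes> (w \<otimes> y [^] k \<otimes> z) \<oplus> w \<otimes> w \<otimes> s"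
proof (induct k)
  case 0
  show ?case using assms by (intro bexI[of _ \<zero>]) auto
next
  case (Suc k)
  then obtain s where s: "s \<in> carrier R" and eq: "(y \<oplus> w \<otimes> z) [^] Suc k =
    y [^] Suc k \<oplus> add_pow R (Suc k) \<one> \<otimes> (w \<otimes> y [^] k \<otimes> z) \<oplus> w \<otimes> w \<otimes> s" by blast
  define e Y where "e = add_pow R (Suc k) \<one>" and "Y = y [^] k"
  have c: "e \<in> carrier R" "Y \<in> carrier R" using assms by (auto simp: e_def Y_def)
  have e': "add_pow R (Suc (Suc k)) \<one> = e \<oplus> \<one>" by (simp add: e_def)
  \<comment> \<open>One more factor \<open>y \<oplus> w \<otimes> z\<close> raises the linear
    coefficient from \<open>e\<close> to \<open>e \<oplus> \<one>\<close>. The new cofactor of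
    \<open>w \<otimes> w\<close> gathers the linear term times \<open>w \<otimes> z\<close> and the
    old remainder times the whole factor.\<close>
  have "(Y \<otimes> y \<oplus> e \<otimes> (w \<otimes> Y \<otimes> z) \<oplus> w \<otimes> w \<otimes> s) \<otimes> (y \<oplus> w \<otimes> z)
    = Y \<otimes> y \<otimes> y \<oplus> (e \<oplus> \<one>) \<otimes> (w \<otimes> (Y \<otimes> y) \<otimes> z)
      \<oplus> w \<otimes> w \<otimes> (e \<otimes> Y \<otimes> z \<otimes> z \<oplus> s \<otimes> (y \<oplus> w \<otimes> z))"
    using c s assms by algebra
  then show ?case
    using c s assms eq by (intro bexI[of _ "e \<otimes> Y \<otimes> z \<otimes> z \<oplus> s \<otimes> (y \<oplus> w \<otimes> z)"])
      (simp_all only: e' nat_pow_Suc eq e_def[symmetric] Y_def[symmetric],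
        auto)
qed

lemma pow_char_add_mult:
  assumes "y \<in> carrier R" "w \<in> carrier R" "z \<in> carrier R"
    and "0 < c" "add_pow R (c::nat) \<one> = \<zero>"
  shows "\<exists>s\<in>carrier R. (y \<oplus> w \<otimes> z) [^] c = y [^] c \<oplus> w \<otimes> w \<otimes> s"
proof -
  obtain k where k: "c = Suc k" using assms(4) gr0_implies_Suc by blast
  show ?thesis using pow_Suc_add_mult[OF assms(1-3), of k] assms unfolding k by auto
qed

text \<open>Each further \<open>c\<close>-th power kills the linear term and squares the factor in
  front of the remainder, which after \<open>j\<close> rounds is
  \<open>w [^] (2 ^ j)\<close>.\<close>

lemma pow_char_power_add:
  assumes "y \<in> carrier R" "w \<in> carrier R" "0 < c" "add_pow R (c::nat) \<one> = \<zero>"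
  shows "\<exists>s\<in>carrier R. (y \<oplus> w) [^] (c ^ j) = y [^] (c ^ j) \<oplus> w [^] ((2::nat) ^ j) \<otimes> s"
proof (induct j)
  case 0
  show ?case using assms by (intro bexI[of _ \<one>]) auto
next
  case (Suc j)
  then obtain s where s: "s \<in> carrier R"
    "(y \<oplus> w) [^] (c ^ j) = y [^] (c ^ j) \<oplus> w [^] ((2::nat) ^ j) \<otimes> s" by blast
  obtain t where t: "t \<in> carrier R"
    "(y [^] (c ^ j) \<oplus> w [^] ((2::nat) ^ j) \<otimes> s) [^] c =
       (y [^] (c ^ j)) [^] c \<oplus> w [^] ((2::nat) ^ j) \<otimes> w [^] ((2::nat) ^ j) \<otimes> t"
    using pow_char_add_mult[OF _ _ s(1) assms(3,4), of "y [^] (c ^ j)" "w [^] ((2::nat) ^ j)"]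
      assms by auto
  have "w [^] ((2::nat) ^ j) \<otimes> w [^] ((2::nat) ^ j) = w [^] ((2::nat) ^ Suc j)"
    using assms by (simp add: nat_pow_mult mult_2)
  moreover have "x [^] (c ^ Suc j) = (x [^] (c ^ j)) [^] c" if "x \<in> carrier R" for x
    using that by (simp add: nat_pow_pow mult.commute)
  ultimately show ?case using s t assms by (intro bexI[of _ t]) auto
qed

lemma pow_eq_of_nilpotent_diff:
  assumes x: "x \<in> carrier R" and y: "y \<in> carrier R"
    and nil: "(x \<ominus> y) [^] (k::nat) = \<zero>" and c: "0 < c" "add_pow R (c::nat) \<one> = \<zero>"
  shows "x [^] (c ^ k) = y [^] (c ^ k)"
proof -
  have xy: "x = y \<oplus> (x \<ominus> y)" using x y by algebra
  \<comment> \<open>The nilpotency exponent \<open>k\<close> also serves as the number of rounds,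
    since \<open>2 ^ k\<close> is at least \<open>k\<close>.\<close>
  have "k \<le> 2 ^ k" using less_exp[of k] by simp
  then have "(x \<ominus> y) [^] ((2::nat) ^ k) = (x \<ominus> y) [^] k \<otimes> (x \<ominus> y) [^] (2 ^ k - k)"
    using x y by (simp add: nat_pow_mult)
  then have "(x \<ominus> y) [^] ((2::nat) ^ k) = \<zero>" using nil x y by simp
  then show ?thesis
    using pow_char_power_add[OF y _ c, of "x \<ominus> y" k] x y xy[symmetric] by auto
qed

end

context ring
begin

text \<open>Only polynomials in \<open>a\<close> occur here, so
  \<open>pow_eq_of_nilpotent_diff\<close> can be applied to \<open>a\<close> and
  \<open>a [^] n\<close> inside a commutative subring and read back in the whole ring.\<close>

lemma power_eq_of_nilpotent_diff:
  assumes a: "a \<in> carrier R" and nil: "(a \<ominus> a [^] (n::nat)) [^] (k::nat) = \<zero>"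
    and c: "0 < c" "add_pow R (c::nat) \<one> = \<zero>"
  shows "a [^] (c ^ k) = a [^] (n * c ^ k)"
proof -
  \<comment> \<open>The bicommutant of \<open>a\<close> is a commutative subring containing \<open>a\<close>.\<close>
  define C where "C = {z \<in> carrier R. z \<otimes> a = a \<otimes> z}"
  define S where "S = {z \<in> carrier R. \<forall>y\<in>C. z \<otimes> y = y \<otimes> z}"
  have aC: "a \<in> C" using a by (auto simp: C_def)
  have aS: "a \<in> S" using a by (auto simp: S_def C_def)
  \<comment> \<open>Every element of \<open>S\<close> commutes with all of \<open>C\<close>, so this
    inclusion makes \<open>S\<close> commutative.\<close>
  have SC: "S \<subseteq> C" using aC a by (auto simp: S_def C_def)
  have Cc: "C \<subseteq> carrier R" by (auto simp: C_def)
  have "subring S R"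
  proof (rule subringI)
    show "\<ominus> h \<in> S" if "h \<in> S" for h
      using that Cc by (auto simp: S_def l_minus r_minus subsetD)
    show "h \<otimes> g \<in> S" if "h \<in> S" "g \<in> S" for h g
    proof -
      have "h \<otimes> g \<otimes> y = y \<otimes> (h \<otimes> g)" if y: "y \<in> C" for y
      proof -
        have yc: "y \<in> carrier R" "h \<in> carrier R" "g \<in> carrier R"
          using y Cc \<open>h \<in> S\<close> \<open>g \<in> S\<close> by (auto simp: S_def)
        have "h \<otimes> g \<otimes> y = h \<otimes> (y \<otimes> g)" using y \<open>g \<in> S\<close> yc by (simp add: S_def m_assoc)
        also have "\<dots> = y \<otimes> h \<otimes> g" using y \<open>h \<in> S\<close> yc by (simp add: S_def m_assoc[symmetric])
        finally show ?thesis using yc by (simp add: m_assoc)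
      qed
      then show ?thesis using that by (auto simp: S_def)
    qed
    show "h \<oplus> g \<in> S" if "h \<in> S" "g \<in> S" for h g
      using that Cc by (auto simp: S_def l_distr r_distr subsetD)
  qed (use Cc in \<open>auto simp: S_def subsetD\<close>)
  then have sub: "subcring S R"
    using SC by (intro subcringI) (auto simp: S_def)
  let ?S = "R\<lparr>carrier := S\<rparr>"
  interpret S: cring ?S
    using sub by (simp add: subcring_iff subcring.axioms subringE(1)[OF \<open>subring S R\<close>])
  have pow: "x [^]\<^bsub>?S\<^esub> (i::nat) = x [^] i" for x i
    by (simp add: nat_pow_def)
  have powS: "a [^] (i::nat) \<in> S" for i
    using S.nat_pow_closed[of a i] aS by (simp add: pow)
  \<comment> \<open>Powers unfold to the same recursion in the subring, but an additive inverse is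
    described relative to the carrier, so uniqueness of inverses is needed to identify the
    two.\<close>
  have minus: "x \<ominus>\<^bsub>?S\<^esub> y = x \<ominus> y" if "x \<in> S" "y \<in> S" for x y
  proof -
    have "y \<oplus> \<ominus>\<^bsub>?S\<^esub> y = \<zero>" "\<ominus>\<^bsub>?S\<^esub> y \<in> S" using S.r_neg[of y] S.a_inv_closed[of y] that by auto
    then have "\<ominus>\<^bsub>?S\<^esub> y = \<ominus> y"
      using that Cc SC by (metis add.inv_equality add.m_comm subsetD)
    then show ?thesis by (simp add: a_minus_def)
  qed
  have "add_pow ?S (i::nat) \<one> = add_pow R i \<one>" for i
    by (simp add: add_pow_def nat_pow_def)
  then have "a [^] (c ^ k) = (a [^] n) [^] (c ^ k)"
    using S.pow_eq_of_nilpotent_diff[of a "a [^] n" k c] aS powS nil c by (simp add: pow minus)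
  then show ?thesis using a by (simp add: nat_pow_pow)
qed

section \<open>Congruences modulo a two-sided ideal\<close>

lemma ideal_cong_mult:
  assumes I: "ideal I R" and c: "a \<in> carrier R" "b \<in> carrier R" "c \<in> carrier R" "d \<in> carrier R"
    and "a \<ominus> b \<in> I" "c \<ominus> d \<in> I"
  shows "a \<otimes> c \<ominus> b \<otimes> d \<in> I"
proof -
  have "(a \<ominus> b) \<otimes> c \<oplus> b \<otimes> (c \<ominus> d) = a \<otimes> c \<oplus> (\<ominus> (b \<otimes> c) \<oplus> (b \<otimes> c \<oplus> \<ominus> (b \<otimes> d)))"
    using c by (simp add: minus_eq l_distr r_distr l_minus r_minus a_assoc)
  also have "\<dots> = a \<otimes> c \<ominus> b \<otimes> d"
    using c by (simp add: minus_eq r_neg1)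
  finally show ?thesis
    using assms ideal_plus_closed[OF I] ideal.I_l_closed[OF I] ideal.I_r_closed[OF I] by metis
qed

lemma ideal_cong_trans:
  assumes I: "ideal I R" and c: "a \<in> carrier R" "b \<in> carrier R" "c \<in> carrier R"
    and "a \<ominus> b \<in> I" "b \<ominus> c \<in> I"
  shows "a \<ominus> c \<in> I"
proof -
  have "(a \<ominus> b) \<oplus> (b \<ominus> c) = a \<ominus> c"
    using c by (simp add: minus_eq a_assoc r_neg1)
  then show ?thesis using assms ideal_plus_closed[OF I] by metis
qed

lemma ideal_cong_sym:
  assumes I: "ideal I R" and c: "a \<in> carrier R" "b \<in> carrier R" and "a \<ominus> b \<in> I"
  shows "b \<ominus> a \<in> I"
proof -
  have "\<zero> \<ominus> (a \<ominus> b) = b \<ominus> a"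
    using c by (simp add: minus_eq minus_add a_comm)
  then show ?thesis using assms ideal_minus_closed[OF I ideal_zero_closed[OF I]] by metis
qed

lemma ideal_cong_pow:
  assumes I: "ideal I R" and c: "a \<in> carrier R" "b \<in> carrier R" and "a \<ominus> b \<in> I"
  shows "a [^] (n::nat) \<ominus> b [^] n \<in> I"
proof (induct n)
  case 0
  show ?case using ideal_zero_closed[OF I] by (simp add: minus_eq r_neg)
next
  case (Suc n)
  then show ?case using assms by (simp add: ideal_cong_mult)
qed

text \<open>Multiplying a congruence by \<open>a [^] k\<close> adds one more period \<open>k\<close>
  to the exponent. This lets an exponent be enlarged, and two exponents be replaced by a common
  one.\<close>

lemma ideal_cong_pow_period:
  assumes I: "ideal I R" and a: "a \<in> carrier R" and k: "a \<ominus> a [^] Suc k \<in> I"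
  shows "a \<ominus> a [^] Suc (k * j) \<in> I"
proof (induct j)
  case 0
  show ?case using a ideal_zero_closed[OF I] by (simp add: minus_eq r_neg)
next
  case (Suc j)
  have "a \<otimes> a [^] k \<ominus> a [^] Suc (k * j) \<otimes> a [^] k \<in> I"
    using a Suc ideal_zero_closed[OF I]
    by (intro ideal_cong_mult[OF I]) (auto simp: minus_eq r_neg)
  moreover have "a \<otimes> a [^] k = a [^] Suc k" using a by (simp only: nat_pow_Suc2)
  moreover have "a [^] Suc (k * j) \<otimes> a [^] k = a [^] Suc (k * Suc j)"
    using a by (simp only: nat_pow_mult) (simp add: add.commute)
  ultimately show ?case
    using a ideal_cong_trans[OF I a _ _ k, of "a [^] Suc (k * Suc j)"] by (metis nat_pow_closed)
qed

text \<open>For the ring element 2 the condition puts the integer \<open>2 ^ n - 2\<close>, positive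
  because \<open>n \<ge> 2\<close>, into the prime radical. As the radical is nil, some power of
  that integer is zero in the ring.\<close>

lemma characteristic_of_periodic_two:
  assumes n: "n \<ge> 2" and mem: "add_pow R (2::nat) \<one> \<ominus> (add_pow R (2::nat) \<one>) [^] (n::nat) \<in> prime_radical R"
  shows "\<exists>c::nat. 0 < c \<and> add_pow R c \<one> = \<zero>"
proof -
  note I = prime_radical_ideal
  define d :: nat where "d = 2 ^ n - 2"
  have "(2::nat) ^ 2 \<le> 2 ^ n" using n by (intro power_increasing) auto
  then have d: "0 < d" and pow: "(2::nat) ^ n = d + 2" by (auto simp: d_def)
  have "(add_pow R (2::nat) \<one>) [^] n = add_pow R d \<one> \<oplus> add_pow R (2::nat) \<one>"
    unfolding add_pow_one_pow pow by (simp add: add.nat_pow_mult)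
  then have "add_pow R d \<one> = (add_pow R (2::nat) \<one>) [^] n \<ominus> add_pow R (2::nat) \<one>"
    by (simp add: minus_eq a_assoc r_neg del: add.nat_pow_Suc)
  then have "add_pow R d \<one> \<in> prime_radical R"
    using ideal_cong_sym[OF I _ _ mem] by simp
  then obtain k :: nat where "(add_pow R d \<one>) [^] k = \<zero>" using prime_radical_nil by blast
  then show ?thesis using d by (intro exI[of _ "d ^ k"]) (simp add: add_pow_one_pow)
qed

theorem strongly_periodic_iff:
  "strongly_periodic R \<longleftrightarrow>
     (\<forall>a\<in>carrier R. \<exists>n::nat. n \<ge> 2 \<and> a \<ominus> a [^] n \<in> prime_radical R)"
  (is "_ \<longleftrightarrow> ?crit")
proof
  note I = prime_radical_ideal
  show ?crit if sp: "strongly_periodic R"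
  proof
    fix a assume a: "a \<in> carrier R"
    then obtain p m where p: "p \<in> carrier R" "a \<ominus> p \<in> prime_radical R"
      and m: "(m::nat) \<ge> 2" "p = p [^] m"
      using sp unfolding strongly_periodic_def potent_def by blast
    \<comment> \<open>Modulo the radical, \<open>a\<close> is congruent to \<open>p\<close>, which
      equals \<open>p [^] m\<close>, which is congruent to \<open>a [^] m\<close>.\<close>
    have "p [^] m \<ominus> a [^] m \<in> prime_radical R"
      using ideal_cong_pow[OF I p(1) a ideal_cong_sym[OF I a p]] .
    then have "a \<ominus> a [^] m \<in> prime_radical R"
      using ideal_cong_trans[OF I a p(1) _ p(2)] a m(2) by simp
    then show "\<exists>n::nat. n \<ge> 2 \<and> a \<ominus> a [^] n \<in> prime_radical R" using m by blast
  qed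
  show "strongly_periodic R" if crit: ?crit
    unfolding strongly_periodic_def potent_def
  proof
    fix a assume a: "a \<in> carrier R"
    obtain c :: nat where c: "0 < c" "add_pow R c \<one> = \<zero>"
      using crit characteristic_of_periodic_two by (metis add.nat_pow_closed one_closed)
    obtain n :: nat where n: "n \<ge> 2" "a \<ominus> a [^] n \<in> prime_radical R" using crit a by blast
    obtain k where k: "n = Suc k" "0 < k" using n(1) by (cases n) auto
    obtain j :: nat where j: "(a \<ominus> a [^] n) [^] j = \<zero>" using prime_radical_nil n by blast
    \<comment> \<open>From exponent \<open>q\<close> on, the powers of \<open>a\<close> repeat with
      period \<open>k * q\<close>, because \<open>n * q = q + k * q\<close>.\<close>
    define q where "q = c ^ j"
    have q: "0 < q" using c by (simp add: q_def)
    have per: "a [^] q = a [^] (q + k * q)"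
      using power_eq_of_nilpotent_diff[OF a j c] k by (simp add: q_def)
    have per': "a [^] (q + s) = a [^] (q + s + k * q * i)" for s i
    proof (induct i)
      case (Suc i)
      have "a [^] (q + s + k * q * i) = a [^] q \<otimes> a [^] (s + k * q * i)"
        using a by (simp add: nat_pow_mult add.assoc)
      also have "\<dots> = a [^] (q + k * q) \<otimes> a [^] (s + k * q * i)" by (simp only: per[symmetric])
      also have "\<dots> = a [^] (q + s + k * q * Suc i)"
        using a by (simp add: nat_pow_mult algebra_simps)
      finally show ?case using Suc by simp
    qed simp
    \<comment> \<open>The exponent \<open>t\<close> is at least \<open>q\<close>, where periodicity
      has begun. It is 1 modulo the period \<open>k * q\<close>, so \<open>t * t\<close> exceeds
      \<open>t\<close> by a multiple of the period and \<open>a [^] t\<close> is potent. It is also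
      1 modulo \<open>k\<close>, so \<open>a [^] t\<close> is congruent to \<open>a\<close>.\<close>
    define t where "t = Suc (k * q)"
    have "q \<le> t" using k by (simp add: t_def le_SucI)
    then have "a [^] t = a [^] (t + k * q * t)" using per'[of "t - q" t] by simp
    moreover have "t + k * q * t = t * t" by (simp add: t_def)
    ultimately have pot: "a [^] t = (a [^] t) [^] t"
      using a by (metis nat_pow_pow)
    have "a \<ominus> a [^] t \<in> prime_radical R"
      unfolding t_def using ideal_cong_pow_period[OF I a] n k by simp
    moreover have "a \<otimes> a [^] t = a [^] t \<otimes> a" using a by (metis nat_pow_Suc nat_pow_Suc2)
    moreover have "t \<ge> 2" using k q by (simp add: t_def Suc_le_eq)
    ultimately show "\<exists>p. (p \<in> carrier R \<and> (\<exists>m::nat\<ge>2. p = p [^] m)) \<and>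
        a \<ominus> p \<in> prime_radical R \<and> a \<otimes> p = p \<otimes> a"
      using a pot by (intro exI[of _ "a [^] t"]) blast
  qed
qed

end

section \<open>Transfer of the prime radical\<close>

text \<open>The model is the projection of a Morita ring to a diagonal entry, where products are off
  by a value of \<open>\<psi>\<close> or \<open>\<phi>\<close>. Followed by the quotient map of
  \<open>S\<close> by its prime radical, \<open>f\<close> is a surjective ring homomorphism.\<close>

locale hom_modulo_radical = R: ring R + S: ring S
  for R :: "('a, 'r) ring_scheme" and S :: "('b, 's) ring_scheme" and f :: "'a \<Rightarrow> 'b" +
  assumes image: "f ` carrier R = carrier S"
    and add: "\<lbrakk>x \<in> carrier R; y \<in> carrier R\<rbrakk> \<Longrightarrow> f (x \<oplus>\<^bsub>R\<^esub> y) = f x \<oplus>\<^bsub>S\<^esub> f y"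
    and one: "f \<one>\<^bsub>R\<^esub> = \<one>\<^bsub>S\<^esub>"
    and mult: "\<lbrakk>x \<in> carrier R; y \<in> carrier R\<rbrakk> \<Longrightarrow>
      f (x \<otimes>\<^bsub>R\<^esub> y) \<ominus>\<^bsub>S\<^esub> f x \<otimes>\<^bsub>S\<^esub> f y \<in> prime_radical S"
begin

lemma closed [simp]: "x \<in> carrier R \<Longrightarrow> f x \<in> carrier S"
  using image by auto

lemma zero: "f \<zero>\<^bsub>R\<^esub> = \<zero>\<^bsub>S\<^esub>"
  using add[of "\<zero>\<^bsub>R\<^esub>" "\<zero>\<^bsub>R\<^esub>"] S.add.l_cancel_one' by fastforce

lemma minus:
  assumes "x \<in> carrier R" "y \<in> carrier R"
  shows "f (x \<ominus>\<^bsub>R\<^esub> y) = f x \<ominus>\<^bsub>S\<^esub> f y"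
proof -
  have "f (\<ominus>\<^bsub>R\<^esub> y) \<oplus>\<^bsub>S\<^esub> f y = \<zero>\<^bsub>S\<^esub>"
    using add[of "\<ominus>\<^bsub>R\<^esub> y" y] assms zero by (simp add: R.l_neg)
  then have "f (\<ominus>\<^bsub>R\<^esub> y) = \<ominus>\<^bsub>S\<^esub> f y"
    using assms S.minus_equality by (metis R.a_inv_closed closed)
  then show ?thesis using assms by (simp add: a_minus_def add)
qed

lemma pow: "x \<in> carrier R \<Longrightarrow> f (x [^]\<^bsub>R\<^esub> (n::nat)) \<ominus>\<^bsub>S\<^esub> f x [^]\<^bsub>S\<^esub> n \<in> prime_radical S"
proof (induct n)
  case 0
  show ?case
    using S.ideal_zero_closed[OF S.prime_radical_ideal] by (simp add: one S.minus_eq S.r_neg)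
next
  case (Suc n)
  have "f (x [^]\<^bsub>R\<^esub> n) \<otimes>\<^bsub>S\<^esub> f x \<ominus>\<^bsub>S\<^esub> f x [^]\<^bsub>S\<^esub> n \<otimes>\<^bsub>S\<^esub> f x \<in> prime_radical S"
    using Suc S.ideal_zero_closed[OF S.prime_radical_ideal]
    by (intro S.ideal_cong_mult[OF S.prime_radical_ideal]) (auto simp: S.minus_eq S.r_neg)
  then show ?case
    using S.ideal_cong_trans[OF S.prime_radical_ideal _ _ _ mult[of "x [^]\<^bsub>R\<^esub> n" x]] Suc(2) by simp
qed

text \<open>A prime ideal \<open>Q\<close> contains the prime radical, so modulo \<open>Q\<close>
  the map \<open>f\<close> is an honest surjective ring homomorphism, and primeness pulls back along
  it.\<close>

lemma prime_vimage:
  assumes Q: "nc_prime_ideal Q S"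
  shows "nc_prime_ideal {x \<in> carrier R. f x \<in> Q} R"
proof (rule R.nc_prime_idealI)
  have I: "ideal Q S" and ne: "Q \<noteq> carrier S" using Q by (auto simp: nc_prime_ideal_def)
  have sub: "prime_radical S \<subseteq> Q" using S.prime_radicalD[OF _ Q] by auto
  have mem: "f (x \<otimes>\<^bsub>R\<^esub> y) \<in> Q \<longleftrightarrow> f x \<otimes>\<^bsub>S\<^esub> f y \<in> Q" if "x \<in> carrier R" "y \<in> carrier R" for x y
  proof -
    have d: "f (x \<otimes>\<^bsub>R\<^esub> y) \<ominus>\<^bsub>S\<^esub> f x \<otimes>\<^bsub>S\<^esub> f y \<in> Q" using mult[OF that] sub by auto
    have "f (x \<otimes>\<^bsub>R\<^esub> y) = (f (x \<otimes>\<^bsub>R\<^esub> y) \<ominus>\<^bsub>S\<^esub> f x \<otimes>\<^bsub>S\<^esub> f y) \<oplus>\<^bsub>S\<^esub> f x \<otimes>\<^bsub>S\<^esub> f y"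
      using that by (simp add: S.minus_eq S.a_assoc S.l_neg)
    moreover have "f x \<otimes>\<^bsub>S\<^esub> f y = f (x \<otimes>\<^bsub>R\<^esub> y) \<ominus>\<^bsub>S\<^esub> (f (x \<otimes>\<^bsub>R\<^esub> y) \<ominus>\<^bsub>S\<^esub> f x \<otimes>\<^bsub>S\<^esub> f y)"
      using that by (simp add: S.minus_eq S.minus_add S.r_neg2)
    ultimately show ?thesis
      using d S.ideal_plus_closed[OF I] S.ideal_minus_closed[OF I] by metis
  qed
  show "ideal {x \<in> carrier R. f x \<in> Q} R"
    by (rule R.idealI_diff)
      (auto simp: zero minus mem S.ideal_zero_closed[OF I] S.ideal_minus_closed[OF I]
        ideal.I_l_closed[OF I] ideal.I_r_closed[OF I])
  show "{x \<in> carrier R. f x \<in> Q} \<noteq> carrier R"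
  proof
    assume "{x \<in> carrier R. f x \<in> Q} = carrier R"
    then have "f \<one>\<^bsub>R\<^esub> \<in> Q" using R.one_closed by blast
    then show False using ideal.one_imp_carrier[OF I] ne one by simp
  qed
  fix x y assume xy: "x \<in> carrier R" "y \<in> carrier R"
    and all: "\<forall>r\<in>carrier R. x \<otimes>\<^bsub>R\<^esub> r \<otimes>\<^bsub>R\<^esub> y \<in> {x \<in> carrier R. f x \<in> Q}"
  have "f x \<otimes>\<^bsub>S\<^esub> s \<otimes>\<^bsub>S\<^esub> f y \<in> Q" if s: "s \<in> carrier S" for s
  proof -
    \<comment> \<open>Surjectivity turns an arbitrary middle factor into some \<open>f r\<close>;
      the error of \<open>f\<close> on \<open>x r\<close>, multiplied by \<open>f y\<close>, stays
      in \<open>Q\<close>.\<close>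
    obtain r where r: "r \<in> carrier R" "s = f r" using s image by auto
    have "f (x \<otimes>\<^bsub>R\<^esub> r) \<otimes>\<^bsub>S\<^esub> f y \<in> Q" using all r xy mem[of "x \<otimes>\<^bsub>R\<^esub> r" y] by auto
    moreover have "(f (x \<otimes>\<^bsub>R\<^esub> r) \<ominus>\<^bsub>S\<^esub> f x \<otimes>\<^bsub>S\<^esub> f r) \<otimes>\<^bsub>S\<^esub> f y \<in> Q"
      using mult[OF xy(1) r(1)] sub xy by (auto intro: ideal.I_r_closed[OF I])
    moreover have "f x \<otimes>\<^bsub>S\<^esub> f r \<otimes>\<^bsub>S\<^esub> f y = f (x \<otimes>\<^bsub>R\<^esub> r) \<otimes>\<^bsub>S\<^esub> f y
      \<ominus>\<^bsub>S\<^esub> (f (x \<otimes>\<^bsub>R\<^esub> r) \<ominus>\<^bsub>S\<^esub> f x \<otimes>\<^bsub>S\<^esub> f r) \<otimes>\<^bsub>S\<^esub> f y"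
      using xy r by (simp add: S.minus_eq S.l_distr S.l_minus S.minus_add S.r_neg2)
    ultimately show ?thesis using S.ideal_minus_closed[OF I] r by metis
  qed
  then have "f x \<in> Q \<or> f y \<in> Q" using S.nc_prime_ideal_memD[OF Q] xy by simp
  then show "x \<in> {x \<in> carrier R. f x \<in> Q} \<or> y \<in> {x \<in> carrier R. f x \<in> Q}" using xy by auto
qed

lemma prime_radical_image: "x \<in> prime_radical R \<Longrightarrow> f x \<in> prime_radical S"
  using R.prime_radicalD[OF _ prime_vimage]
  by (intro S.prime_radicalI) (auto simp: prime_radical_def)

text \<open>A potent element need not have a potent image, since \<open>f\<close> respects products
  only modulo the radical. The criterion \<open>strongly_periodic_iff\<close> transfers with the
  same exponent.\<close>

lemma strongly_periodic_image:
  assumes "strongly_periodic R" shows "strongly_periodic S"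
  unfolding S.strongly_periodic_iff
proof
  note I = S.prime_radical_ideal
  fix a assume "a \<in> carrier S"
  then obtain x where x: "x \<in> carrier R" "a = f x" using image by auto
  then obtain n :: nat where n: "n \<ge> 2" "x \<ominus>\<^bsub>R\<^esub> x [^]\<^bsub>R\<^esub> n \<in> prime_radical R"
    using assms by (auto simp: R.strongly_periodic_iff)
  have "f x \<ominus>\<^bsub>S\<^esub> f (x [^]\<^bsub>R\<^esub> n) \<in> prime_radical S"
    using prime_radical_image[OF n(2)] x by (simp add: minus)
  then have "a \<ominus>\<^bsub>S\<^esub> a [^]\<^bsub>S\<^esub> n \<in> prime_radical S"
    using S.ideal_cong_trans[OF I _ _ _ _ pow[OF x(1), of n]] x by simp
  then show "\<exists>n::nat. n \<ge> 2 \<and> a \<ominus>\<^bsub>S\<^esub> a [^]\<^bsub>S\<^esub> n \<in> prime_radical S" using n by blast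
qed

lemma power_cong:
  assumes x: "x \<in> carrier R" and "f x \<ominus>\<^bsub>S\<^esub> f x [^]\<^bsub>S\<^esub> (n::nat) \<in> prime_radical S"
  shows "f (x \<ominus>\<^bsub>R\<^esub> x [^]\<^bsub>R\<^esub> n) \<in> prime_radical S"
proof -
  note I = S.prime_radical_ideal
  have "f x [^]\<^bsub>S\<^esub> n \<ominus>\<^bsub>S\<^esub> f (x [^]\<^bsub>R\<^esub> n) \<in> prime_radical S"
    using S.ideal_cong_sym[OF I _ _ pow[OF x, of n]] x by simp
  then show ?thesis
    using S.ideal_cong_trans[OF I _ _ _ assms(2)] x by (simp add: minus)
qed

end

text \<open>The hypotheses say that \<open>i\<close> embeds \<open>R\<close> as a corner \<open>e S e\<close>, with \<open>e = i \<one>\<close>.\<close>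

lemma prime_radical_corner:
  fixes R :: "('a, 'r) ring_scheme" and S :: "('b, 's) ring_scheme" and i :: "'a \<Rightarrow> 'b"
  assumes "ring R" "ring S" and closed: "\<And>a. a \<in> carrier R \<Longrightarrow> i a \<in> carrier S"
    and add: "\<And>a b. \<lbrakk>a \<in> carrier R; b \<in> carrier R\<rbrakk> \<Longrightarrow> i (a \<oplus>\<^bsub>R\<^esub> b) = i a \<oplus>\<^bsub>S\<^esub> i b"
    and mult: "\<And>a b. \<lbrakk>a \<in> carrier R; b \<in> carrier R\<rbrakk> \<Longrightarrow> i (a \<otimes>\<^bsub>R\<^esub> b) = i a \<otimes>\<^bsub>S\<^esub> i b"
    and corner: "\<And>s. s \<in> carrier S \<Longrightarrow> \<exists>r\<in>carrier R. \<forall>a\<in>carrier R. \<forall>b\<in>carrier R.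
      i a \<otimes>\<^bsub>S\<^esub> s \<otimes>\<^bsub>S\<^esub> i b = i (a \<otimes>\<^bsub>R\<^esub> r \<otimes>\<^bsub>R\<^esub> b)"
    and x: "x \<in> prime_radical R"
  shows "i x \<in> prime_radical S"
proof -
  interpret R: ring R by fact
  interpret S: ring S by fact
  have xc: "x \<in> carrier R" using x by (simp add: prime_radical_def)
  have zero: "i \<zero>\<^bsub>R\<^esub> = \<zero>\<^bsub>S\<^esub>"
    using add[of "\<zero>\<^bsub>R\<^esub>" "\<zero>\<^bsub>R\<^esub>"] closed S.add.l_cancel_one' by fastforce
  have minus: "i (a \<ominus>\<^bsub>R\<^esub> b) = i a \<ominus>\<^bsub>S\<^esub> i b" if "a \<in> carrier R" "b \<in> carrier R" for a b
  proof -
    have "i (\<ominus>\<^bsub>R\<^esub> b) \<oplus>\<^bsub>S\<^esub> i b = \<zero>\<^bsub>S\<^esub>"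
      using add[of "\<ominus>\<^bsub>R\<^esub> b" b] that zero by (simp add: R.l_neg)
    then have "i (\<ominus>\<^bsub>R\<^esub> b) = \<ominus>\<^bsub>S\<^esub> i b"
      using that S.minus_equality by (metis R.a_inv_closed closed)
    then show ?thesis using that by (simp add: a_minus_def add)
  qed
  show ?thesis
  proof (rule S.prime_radicalI)
    fix Q assume Q: "nc_prime_ideal Q S"
    then have I: "ideal Q S" by (simp add: nc_prime_ideal_def)
    let ?Q = "{a \<in> carrier R. i a \<in> Q}"
    have Q': "ideal ?Q R"
      by (rule R.idealI_diff)
        (auto simp: zero minus mult closed S.ideal_zero_closed[OF I] S.ideal_minus_closed[OF I]
          ideal.I_l_closed[OF I] ideal.I_r_closed[OF I])
    \<comment> \<open>The map \<open>i\<close> need not preserve the unit, so the preimage of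
      \<open>Q\<close> can be everything; in that case \<open>i x \<in> Q\<close> is immediate.
      Otherwise the corner hypothesis carries the elementwise test from \<open>R\<close> to
      \<open>S\<close>.\<close>
    have "nc_prime_ideal ?Q R" if "?Q \<noteq> carrier R"
    proof (rule R.nc_prime_idealI[OF Q' that])
      fix a b assume ab: "a \<in> carrier R" "b \<in> carrier R"
        and all: "\<forall>r\<in>carrier R. a \<otimes>\<^bsub>R\<^esub> r \<otimes>\<^bsub>R\<^esub> b \<in> ?Q"
      have "i a \<otimes>\<^bsub>S\<^esub> s \<otimes>\<^bsub>S\<^esub> i b \<in> Q" if "s \<in> carrier S" for s
        using corner[OF that] ab all by auto
      then show "a \<in> ?Q \<or> b \<in> ?Q"
        using S.nc_prime_ideal_memD[OF Q closed[OF ab(1)] closed[OF ab(2)]] ab by auto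
    qed
    then show "i x \<in> Q" using R.prime_radicalD[OF x, of ?Q] xc by auto
  qed (use xc closed in auto)
qed

section \<open>Tensor products of bimodules\<close>

locale bimodule_pair = X: bimodule A B X + Y: bimodule B C Y
  for A :: "('a, 'r) ring_scheme" and B :: "('b, 's) ring_scheme" and C :: "('c, 't) ring_scheme"
    and X :: "('a, 'b, 'x, 'e) bimodule_scheme" and Y :: "('b, 'c, 'y, 'f) bimodule_scheme"
begin

lemma frag_of_carrier: "\<lbrakk>x \<in> carrier X; y \<in> carrier Y\<rbrakk> \<Longrightarrow> frag_of (x, y) \<in> carrier (tensor_free X Y)"
  by simp

lemma tensor_relators_carrier: "tensor_relators B X Y \<subseteq> carrier (tensor_free X Y)"
proof -
  interpret G: group "tensor_free X Y" by simp
  have diff: "u - v \<in> carrier (tensor_free X Y)"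
    if "u \<in> carrier (tensor_free X Y)" "v \<in> carrier (tensor_free X Y)" for u v
    using G.m_closed[OF that(1) G.inv_closed[OF that(2)]] that by simp
  show ?thesis
    unfolding tensor_relators_def
    by (auto simp del: carrier_free_Abelian_group_iff intro!: diff frag_of_carrier
        X.rsmult_closed Y.lsmult_closed)
qed

lemma tensor_rel_normal: "tensor_rel B X Y \<lhd> tensor_free X Y"
proof -
  interpret G: comm_group "tensor_free X Y" by (rule abelian_free_Abelian_group)
  show ?thesis
    unfolding tensor_rel_def
    using G.generate_is_subgroup[OF tensor_relators_carrier] G.subgroup_imp_normal by blast
qed

lemma relator_mem: "g \<in> tensor_relators B X Y \<Longrightarrow> g \<in> tensor_rel B X Y"
  unfolding tensor_rel_def by (rule generate.incl)

lemma coset_eqI: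
  assumes "u \<in> carrier (tensor_free X Y)" "u - v \<in> tensor_rel B X Y"
  shows "tensor_rel B X Y #>\<^bsub>tensor_free X Y\<^esub> u = tensor_rel B X Y #>\<^bsub>tensor_free X Y\<^esub> v"
proof -
  interpret H: normal "tensor_rel B X Y" "tensor_free X Y" by (rule tensor_rel_normal)
  have mem: "v - u \<in> tensor_rel B X Y"
    using H.m_inv_closed[OF assms(2)] H.subset[THEN subsetD, OF assms(2)] by simp
  have "v = (v - u) \<otimes>\<^bsub>tensor_free X Y\<^esub> u" by simp
  then have "v \<in> tensor_rel B X Y #>\<^bsub>tensor_free X Y\<^esub> u"
    using mem unfolding r_coset_def by blast
  then show ?thesis
    using H.repr_independence[OF _ assms(1) H.is_subgroup] by simp
qed

lemma pure_tensor_closed: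
  assumes "x \<in> carrier X" "y \<in> carrier Y"
  shows "pure_tensor B X Y x y \<in> carrier (tensor_bimodule B X Y)"
  using frag_of_carrier[OF assms]
  unfolding tensor_bimodule_def pure_tensor_def FactGroup_def RCOSETS_def by auto

text \<open>Both additivity laws have this shape: cosets add through representatives, and a relator
  identifies one generator with the sum of two others.\<close>

lemma pure_tensor_add_eqI:
  assumes "x \<in> carrier X" "y \<in> carrier Y" "x' \<in> carrier X" "y' \<in> carrier Y"
    "x'' \<in> carrier X" "y'' \<in> carrier Y"
    and "frag_of (x, y) - frag_of (x', y') - frag_of (x'', y'') \<in> tensor_relators B X Y"
  shows "pure_tensor B X Y x y =
    pure_tensor B X Y x' y' \<oplus>\<^bsub>tensor_bimodule B X Y\<^esub> pure_tensor B X Y x'' y''"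
proof -
  interpret H: normal "tensor_rel B X Y" "tensor_free X Y" by (rule tensor_rel_normal)
  have "tensor_rel B X Y #>\<^bsub>tensor_free X Y\<^esub> frag_of (x, y) =
    tensor_rel B X Y #>\<^bsub>tensor_free X Y\<^esub> (frag_of (x', y') + frag_of (x'', y''))"
    using assms relator_mem[OF assms(7)] by (intro coset_eqI) (auto simp: algebra_simps)
  then show ?thesis
    using H.rcos_sum[OF frag_of_carrier[OF assms(3,4)] frag_of_carrier[OF assms(5,6)]]
    by (simp add: pure_tensor_def tensor_bimodule_def)
qed

lemma pure_tensor_add_left:
  assumes "x \<in> carrier X" "x' \<in> carrier X" "y \<in> carrier Y"
  shows "pure_tensor B X Y (x \<oplus>\<^bsub>X\<^esub> x') y =
    pure_tensor B X Y x y \<oplus>\<^bsub>tensor_bimodule B X Y\<^esub> pure_tensor B X Y x' y"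
  using assms by (intro pure_tensor_add_eqI) (auto simp: tensor_relators_def)

lemma pure_tensor_add_right:
  assumes "x \<in> carrier X" "y \<in> carrier Y" "y' \<in> carrier Y"
  shows "pure_tensor B X Y x (y \<oplus>\<^bsub>Y\<^esub> y') =
    pure_tensor B X Y x y \<oplus>\<^bsub>tensor_bimodule B X Y\<^esub> pure_tensor B X Y x y'"
  using assms by (intro pure_tensor_add_eqI) (auto simp: tensor_relators_def)

lemma pure_tensor_balanced:
  assumes "x \<in> carrier X" "b \<in> carrier B" "y \<in> carrier Y"
  shows "pure_tensor B X Y (x \<odot>\<^sub>r\<^bsub>X\<^esub> b) y = pure_tensor B X Y x (b \<odot>\<^bsub>Y\<^esub> y)"
  unfolding pure_tensor_def
  using assms by (intro coset_eqI relator_mem)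
    (auto simp: tensor_relators_def X.rsmult_closed)

text \<open>An additive map sending relators to relations sends the whole relation subgroup into
  itself, so only the representative matters. This evaluates the actions on the tensor bimodule,
  which are defined elementwise on cosets.\<close>

lemma frag_extend_coset:
  assumes rel: "\<And>g. g \<in> tensor_relators B X Y \<Longrightarrow> frag_extend F g \<in> tensor_rel B X Y"
    and u: "u \<in> carrier (tensor_free X Y)" and Fu: "frag_extend F u \<in> carrier (tensor_free X Y)"
  shows "tensor_rel B X Y <#>\<^bsub>tensor_free X Y\<^esub>
      (frag_extend F ` (tensor_rel B X Y #>\<^bsub>tensor_free X Y\<^esub> u)) =
    tensor_rel B X Y #>\<^bsub>tensor_free X Y\<^esub> frag_extend F u"
proof -
  interpret H: normal "tensor_rel B X Y" "tensor_free X Y" by (rule tensor_rel_normal)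
  have FH: "frag_extend F h \<in> tensor_rel B X Y" if "h \<in> tensor_rel B X Y" for h
    using that unfolding tensor_rel_def
  proof (induct rule: generate.induct)
    case one
    show ?case using generate.one[of "tensor_free X Y"] by simp
  next
    case (incl h)
    then show ?case using rel by (simp add: tensor_rel_def)
  next
    case (inv h)
    have *: "frag_extend F h \<in> tensor_rel B X Y" using inv rel by simp
    have "- frag_extend F h \<in> tensor_rel B X Y"
      using H.m_inv_closed[OF *] H.subset[THEN subsetD, OF *] by simp
    moreover have "h \<in> carrier (tensor_free X Y)" using inv tensor_relators_carrier by blast
    ultimately show ?case by (simp add: frag_extend_minus tensor_rel_def)
  next
    case (eng h1 h2)
    then show ?case
      using generate.eng[of _ "tensor_free X Y"] by (simp add: frag_extend_add)
  qed
  show ?thesis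
  proof (intro equalityI subsetI)
    fix z assume "z \<in> tensor_rel B X Y <#>\<^bsub>tensor_free X Y\<^esub>
      (frag_extend F ` (tensor_rel B X Y #>\<^bsub>tensor_free X Y\<^esub> u))"
    then obtain h k where hk: "h \<in> tensor_rel B X Y" "k \<in> tensor_rel B X Y"
      "z = h + frag_extend F (k + u)"
      unfolding set_mult_def r_coset_def by auto
    have "h + frag_extend F k \<in> tensor_rel B X Y"
      using subgroup.m_closed[OF H.is_subgroup hk(1) FH[OF hk(2)]] by simp
    moreover have "z = (h + frag_extend F k) + frag_extend F u"
      using hk by (simp add: frag_extend_add)
    ultimately show "z \<in> tensor_rel B X Y #>\<^bsub>tensor_free X Y\<^esub> frag_extend F u"
      unfolding r_coset_def by auto
  next
    fix z assume "z \<in> tensor_rel B X Y #>\<^bsub>tensor_free X Y\<^esub> frag_extend F u"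
    then obtain h where h: "h \<in> tensor_rel B X Y" "z = h + frag_extend F u"
      unfolding r_coset_def by auto
    have "u \<in> tensor_rel B X Y #>\<^bsub>tensor_free X Y\<^esub> u"
      by (rule H.rcos_self[OF u H.is_subgroup])
    then show "z \<in> tensor_rel B X Y <#>\<^bsub>tensor_free X Y\<^esub>
      (frag_extend F ` (tensor_rel B X Y #>\<^bsub>tensor_free X Y\<^esub> u))"
      using h unfolding set_mult_def by auto
  qed
qed

lemma pure_tensor_smult:
  assumes a: "a \<in> carrier A" and x: "x \<in> carrier X" and y: "y \<in> carrier Y"
  shows "a \<odot>\<^bsub>tensor_bimodule B X Y\<^esub> pure_tensor B X Y x y = pure_tensor B X Y (a \<odot>\<^bsub>X\<^esub> x) y"
proof -
  let ?F = "\<lambda>(x, y). frag_of (a \<odot>\<^bsub>X\<^esub> x, y)"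
  \<comment> \<open>Each family of relators is mapped into itself: the first by additivity of the
    left action, the second directly, the third because the left and right actions on
    \<open>X\<close> commute.\<close>
  have "frag_extend ?F g \<in> tensor_relators B X Y" if "g \<in> tensor_relators B X Y" for g
    using that unfolding tensor_relators_def
    by (auto simp: frag_extend_diff X.lsmult_r_distr[OF a] X.smult_rsmult_assoc[OF a, symmetric])
      (use X.lsmult_closed[OF a] in blast)+
  then have "tensor_rel B X Y <#>\<^bsub>tensor_free X Y\<^esub>
      (frag_extend ?F ` (tensor_rel B X Y #>\<^bsub>tensor_free X Y\<^esub> frag_of (x, y))) =
    tensor_rel B X Y #>\<^bsub>tensor_free X Y\<^esub> frag_extend ?F (frag_of (x, y))"
    using a x y X.lsmult_closed[OF a x] by (intro frag_extend_coset relator_mem) auto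
  then show ?thesis by (simp add: pure_tensor_def tensor_bimodule_def)
qed

lemma pure_tensor_rsmult:
  assumes x: "x \<in> carrier X" and y: "y \<in> carrier Y" and c: "c \<in> carrier C"
  shows "pure_tensor B X Y x y \<odot>\<^sub>r\<^bsub>tensor_bimodule B X Y\<^esub> c = pure_tensor B X Y x (y \<odot>\<^sub>r\<^bsub>Y\<^esub> c)"
proof -
  let ?F = "\<lambda>(x, y). frag_of (x, y \<odot>\<^sub>r\<^bsub>Y\<^esub> c)"
  have "frag_extend ?F g \<in> tensor_relators B X Y" if "g \<in> tensor_relators B X Y" for g
    using that unfolding tensor_relators_def
    by (auto simp: frag_extend_diff Y.rsmult_l_distr[OF _ _ c] Y.smult_rsmult_assoc[OF _ _ c])
      (use Y.rsmult_closed[OF _ c] in blast)+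
  then have "tensor_rel B X Y <#>\<^bsub>tensor_free X Y\<^esub>
      (frag_extend ?F ` (tensor_rel B X Y #>\<^bsub>tensor_free X Y\<^esub> frag_of (x, y))) =
    tensor_rel B X Y #>\<^bsub>tensor_free X Y\<^esub> frag_extend ?F (frag_of (x, y))"
    using c x y Y.rsmult_closed[OF y c] by (intro frag_extend_coset relator_mem) auto
  then show ?thesis by (simp add: pure_tensor_def tensor_bimodule_def)
qed

end

section \<open>The ring of a Morita context\<close>

context bimodule
begin

lemma lsmult_zero [simp]: "a \<in> carrier A \<Longrightarrow> a \<odot>\<^bsub>M\<^esub> \<zero>\<^bsub>M\<^esub> = \<zero>\<^bsub>M\<^esub>"
  using lsmult_r_distr[of a "\<zero>\<^bsub>M\<^esub>" "\<zero>\<^bsub>M\<^esub>"] lsmult_closed[of a "\<zero>\<^bsub>M\<^esub>"]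
    M.add.l_cancel_one' by fastforce

lemma zero_lsmult [simp]: "x \<in> carrier M \<Longrightarrow> \<zero>\<^bsub>A\<^esub> \<odot>\<^bsub>M\<^esub> x = \<zero>\<^bsub>M\<^esub>"
  using lsmult_l_distr[of "\<zero>\<^bsub>A\<^esub>" "\<zero>\<^bsub>A\<^esub>" x] lsmult_closed[of "\<zero>\<^bsub>A\<^esub>" x]
    M.add.l_cancel_one' by fastforce

lemma zero_rsmult [simp]: "b \<in> carrier B \<Longrightarrow> \<zero>\<^bsub>M\<^esub> \<odot>\<^sub>r\<^bsub>M\<^esub> b = \<zero>\<^bsub>M\<^esub>"
  using rsmult_l_distr[of "\<zero>\<^bsub>M\<^esub>" "\<zero>\<^bsub>M\<^esub>" b] rsmult_closed[of "\<zero>\<^bsub>M\<^esub>" b]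
    M.add.l_cancel_one' by fastforce

lemma rsmult_zero [simp]: "x \<in> carrier M \<Longrightarrow> x \<odot>\<^sub>r\<^bsub>M\<^esub> \<zero>\<^bsub>B\<^esub> = \<zero>\<^bsub>M\<^esub>"
  using rsmult_r_distr[of x "\<zero>\<^bsub>B\<^esub>" "\<zero>\<^bsub>B\<^esub>"] rsmult_closed[of x "\<zero>\<^bsub>B\<^esub>"]
    M.add.l_cancel_one' by fastforce

end

lemma bimodule_hom_regular:
  assumes "f \<in> bimodule_hom A A X (regular_bimodule A)"
  shows "x \<in> carrier X \<Longrightarrow> f x \<in> carrier A"
    and "\<lbrakk>x \<in> carrier X; y \<in> carrier X\<rbrakk> \<Longrightarrow> f (x \<oplus>\<^bsub>X\<^esub> y) = f x \<oplus>\<^bsub>A\<^esub> f y"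
    and "\<lbrakk>a \<in> carrier A; x \<in> carrier X\<rbrakk> \<Longrightarrow> f (a \<odot>\<^bsub>X\<^esub> x) = a \<otimes>\<^bsub>A\<^esub> f x"
    and "\<lbrakk>x \<in> carrier X; a \<in> carrier A\<rbrakk> \<Longrightarrow> f (x \<odot>\<^sub>r\<^bsub>X\<^esub> a) = f x \<otimes>\<^bsub>A\<^esub> a"
  using assms by (auto simp: bimodule_hom_def regular_bimodule_def)

section \<open>The two pairings and the ring axioms\<close>

context morita_context
begin

text \<open>The multiplication of \<open>T\<close> sees \<open>\<psi>\<close> and
  \<open>\<phi>\<close> only on pure tensors, that is, as the balanced biadditive pairings
  \<open>p\<close> and \<open>q\<close>.\<close>

abbreviation p where "p n m \<equiv> \<psi> (pure_tensor B N M n m)"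
abbreviation q where "q m n \<equiv> \<phi> (pure_tensor A M N m n)"
abbreviation T where "T \<equiv> morita_ring A B M N \<psi> \<phi>"

sublocale NM: bimodule_pair A B A N M by unfold_locales
sublocale MN: bimodule_pair B A B M N by unfold_locales

lemmas psi_rules = bimodule_hom_regular[OF psi_hom]
lemmas phi_rules = bimodule_hom_regular[OF phi_hom]

lemma p_closed [simp]: "\<lbrakk>n \<in> carrier N; m \<in> carrier M\<rbrakk> \<Longrightarrow> p n m \<in> carrier A"
  by (simp add: psi_rules NM.pure_tensor_closed)

lemma q_closed [simp]: "\<lbrakk>m \<in> carrier M; n \<in> carrier N\<rbrakk> \<Longrightarrow> q m n \<in> carrier B"
  by (simp add: phi_rules MN.pure_tensor_closed)

lemma p_bilinear:
  "\<lbrakk>n \<in> carrier N; n' \<in> carrier N; m \<in> carrier M\<rbrakk> \<Longrightarrow> p (n \<oplus>\<^bsub>N\<^esub> n') m = p n m \<oplus>\<^bsub>A\<^esub> p n' m"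
  "\<lbrakk>n \<in> carrier N; m \<in> carrier M; m' \<in> carrier M\<rbrakk> \<Longrightarrow> p n (m \<oplus>\<^bsub>M\<^esub> m') = p n m \<oplus>\<^bsub>A\<^esub> p n m'"
  "\<lbrakk>a \<in> carrier A; n \<in> carrier N; m \<in> carrier M\<rbrakk> \<Longrightarrow> p (a \<odot>\<^bsub>N\<^esub> n) m = a \<otimes>\<^bsub>A\<^esub> p n m"
  "\<lbrakk>n \<in> carrier N; m \<in> carrier M; a \<in> carrier A\<rbrakk> \<Longrightarrow> p n (m \<odot>\<^sub>r\<^bsub>M\<^esub> a) = p n m \<otimes>\<^bsub>A\<^esub> a"
  "\<lbrakk>n \<in> carrier N; b \<in> carrier B; m \<in> carrier M\<rbrakk> \<Longrightarrow> p (n \<odot>\<^sub>r\<^bsub>N\<^esub> b) m = p n (b \<odot>\<^bsub>M\<^esub> m)"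
  by (simp_all add: NM.pure_tensor_add_left NM.pure_tensor_add_right NM.pure_tensor_balanced
      NM.pure_tensor_smult[symmetric] NM.pure_tensor_rsmult[symmetric]
      psi_rules NM.pure_tensor_closed)

lemma q_bilinear:
  "\<lbrakk>m \<in> carrier M; m' \<in> carrier M; n \<in> carrier N\<rbrakk> \<Longrightarrow> q (m \<oplus>\<^bsub>M\<^esub> m') n = q m n \<oplus>\<^bsub>B\<^esub> q m' n"
  "\<lbrakk>m \<in> carrier M; n \<in> carrier N; n' \<in> carrier N\<rbrakk> \<Longrightarrow> q m (n \<oplus>\<^bsub>N\<^esub> n') = q m n \<oplus>\<^bsub>B\<^esub> q m n'"
  "\<lbrakk>b \<in> carrier B; m \<in> carrier M; n \<in> carrier N\<rbrakk> \<Longrightarrow> q (b \<odot>\<^bsub>M\<^esub> m) n = b \<otimes>\<^bsub>B\<^esub> q m n"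
  "\<lbrakk>m \<in> carrier M; n \<in> carrier N; b \<in> carrier B\<rbrakk> \<Longrightarrow> q m (n \<odot>\<^sub>r\<^bsub>N\<^esub> b) = q m n \<otimes>\<^bsub>B\<^esub> b"
  "\<lbrakk>m \<in> carrier M; a \<in> carrier A; n \<in> carrier N\<rbrakk> \<Longrightarrow> q (m \<odot>\<^sub>r\<^bsub>M\<^esub> a) n = q m (a \<odot>\<^bsub>N\<^esub> n)"
  by (simp_all add: MN.pure_tensor_add_left MN.pure_tensor_add_right MN.pure_tensor_balanced
      MN.pure_tensor_smult[symmetric] MN.pure_tensor_rsmult[symmetric]
      phi_rules MN.pure_tensor_closed)

lemma p_zero [simp]:
  "m \<in> carrier M \<Longrightarrow> p \<zero>\<^bsub>N\<^esub> m = \<zero>\<^bsub>A\<^esub>"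
  "n \<in> carrier N \<Longrightarrow> p n \<zero>\<^bsub>M\<^esub> = \<zero>\<^bsub>A\<^esub>"
  using p_bilinear(3)[of "\<zero>\<^bsub>A\<^esub>" "\<zero>\<^bsub>N\<^esub>" m] p_bilinear(4)[of n "\<zero>\<^bsub>M\<^esub>" "\<zero>\<^bsub>A\<^esub>"] by auto

lemma q_zero [simp]:
  "n \<in> carrier N \<Longrightarrow> q \<zero>\<^bsub>M\<^esub> n = \<zero>\<^bsub>B\<^esub>"
  "m \<in> carrier M \<Longrightarrow> q m \<zero>\<^bsub>N\<^esub> = \<zero>\<^bsub>B\<^esub>"
  using q_bilinear(3)[of "\<zero>\<^bsub>B\<^esub>" "\<zero>\<^bsub>M\<^esub>" n] q_bilinear(4)[of m "\<zero>\<^bsub>N\<^esub>" "\<zero>\<^bsub>B\<^esub>"] by auto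

lemma carrier_T: "carrier T = carrier A \<times> carrier N \<times> carrier M \<times> carrier B"
  by (simp add: morita_ring_def)

lemma mult_T: "(a, n, m, b) \<otimes>\<^bsub>T\<^esub> (a', n', m', b') =
    (a \<otimes>\<^bsub>A\<^esub> a' \<oplus>\<^bsub>A\<^esub> p n m', a \<odot>\<^bsub>N\<^esub> n' \<oplus>\<^bsub>N\<^esub> n \<odot>\<^sub>r\<^bsub>N\<^esub> b',
     m \<odot>\<^sub>r\<^bsub>M\<^esub> a' \<oplus>\<^bsub>M\<^esub> b \<odot>\<^bsub>M\<^esub> m', q m n' \<oplus>\<^bsub>B\<^esub> b \<otimes>\<^bsub>B\<^esub> b')"
  by (simp add: morita_ring_def)

lemma add_T: "(a, n, m, b) \<oplus>\<^bsub>T\<^esub> (a', n', m', b') =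
    (a \<oplus>\<^bsub>A\<^esub> a', n \<oplus>\<^bsub>N\<^esub> n', m \<oplus>\<^bsub>M\<^esub> m', b \<oplus>\<^bsub>B\<^esub> b')"
  by (simp add: morita_ring_def)

lemma zero_T: "\<zero>\<^bsub>T\<^esub> = (\<zero>\<^bsub>A\<^esub>, \<zero>\<^bsub>N\<^esub>, \<zero>\<^bsub>M\<^esub>, \<zero>\<^bsub>B\<^esub>)"
  by (simp add: morita_ring_def)

lemma one_T: "\<one>\<^bsub>T\<^esub> = (\<one>\<^bsub>A\<^esub>, \<zero>\<^bsub>N\<^esub>, \<zero>\<^bsub>M\<^esub>, \<one>\<^bsub>B\<^esub>)"
  by (simp add: morita_ring_def)

lemmas T_simps = carrier_T mult_T add_T zero_T one_T

lemmas action_closed =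
  N.lsmult_closed N.rsmult_closed M.lsmult_closed M.rsmult_closed

lemmas action_distr =
  N.lsmult_l_distr N.lsmult_r_distr N.rsmult_l_distr N.rsmult_r_distr
  M.lsmult_l_distr M.lsmult_r_distr M.rsmult_l_distr M.rsmult_r_distr

lemmas action_assoc =
  N.lsmult_assoc N.rsmult_assoc N.smult_rsmult_assoc
  M.lsmult_assoc M.rsmult_assoc M.smult_rsmult_assoc

lemma ring_T: "ring T"
proof (rule ringI)
  show "abelian_group T"
  proof (rule abelian_groupI)
    fix x assume x: "x \<in> carrier T"
    then obtain a n m b where x: "x = (a, n, m, b)" "a \<in> carrier A" "n \<in> carrier N"
      "m \<in> carrier M" "b \<in> carrier B" by (auto simp: carrier_T)
    then show "\<exists>y\<in>carrier T. y \<oplus>\<^bsub>T\<^esub> x = \<zero>\<^bsub>T\<^esub>"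
      by (intro bexI[of _ "(\<ominus>\<^bsub>A\<^esub> a, \<ominus>\<^bsub>N\<^esub> n, \<ominus>\<^bsub>M\<^esub> m, \<ominus>\<^bsub>B\<^esub> b)"])
        (auto simp: T_simps N.A.l_neg N.B.l_neg N.M.l_neg M.M.l_neg)
  qed (auto simp: T_simps N.A.a_ac N.B.a_ac N.M.a_ac M.M.a_ac)
  show "monoid T"
  proof (rule monoidI)
    \<comment> \<open>On the diagonal, associativity rests on the bilinearity and balancedness of
      \<open>p\<close> and \<open>q\<close>; off the diagonal it is exactly \<open>psi_phi\<close>
      and \<open>phi_psi\<close> that match the mixed terms.\<close>
    fix x y z assume "x \<in> carrier T" "y \<in> carrier T" "z \<in> carrier T"
    then show "x \<otimes>\<^bsub>T\<^esub> y \<otimes>\<^bsub>T\<^esub> z = x \<otimes>\<^bsub>T\<^esub> (y \<otimes>\<^bsub>T\<^esub> z)"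
      by (auto simp: T_simps action_closed action_distr action_assoc p_bilinear q_bilinear
          psi_phi phi_psi N.A.l_distr N.A.r_distr N.B.l_distr N.B.r_distr N.A.m_assoc N.B.m_assoc
          N.A.a_ac N.B.a_ac N.M.a_ac M.M.a_ac)
  qed (auto simp: T_simps action_closed N.lsmult_one N.rsmult_one M.lsmult_one M.rsmult_one)
  fix x y z assume "x \<in> carrier T" "y \<in> carrier T" "z \<in> carrier T"
  then show "(x \<oplus>\<^bsub>T\<^esub> y) \<otimes>\<^bsub>T\<^esub> z = x \<otimes>\<^bsub>T\<^esub> z \<oplus>\<^bsub>T\<^esub> y \<otimes>\<^bsub>T\<^esub> z"
    "z \<otimes>\<^bsub>T\<^esub> (x \<oplus>\<^bsub>T\<^esub> y) = z \<otimes>\<^bsub>T\<^esub> x \<oplus>\<^bsub>T\<^esub> z \<otimes>\<^bsub>T\<^esub> y"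
    by (auto simp: T_simps action_closed action_distr p_bilinear q_bilinear
        N.A.l_distr N.A.r_distr N.B.l_distr N.B.r_distr N.A.a_ac N.B.a_ac N.M.a_ac M.M.a_ac)
qed

end

section \<open>Morita contexts whose pairings take values in the prime radicals\<close>

locale radical_morita_context = morita_context +
  assumes p_radical: "\<lbrakk>n \<in> carrier N; m \<in> carrier M\<rbrakk> \<Longrightarrow> p n m \<in> prime_radical A"
    and q_radical: "\<lbrakk>m \<in> carrier M; n \<in> carrier N\<rbrakk> \<Longrightarrow> q m n \<in> prime_radical B"
begin

sublocale T: ring T by (rule ring_T)

text \<open>The error of \<open>fst\<close> on a product is exactly a value of \<open>p\<close>,
  which is radical by assumption.\<close>

sublocale pA: hom_modulo_radical T A fst
proof unfold_locales
  show "fst ` carrier T = carrier A"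
    using N.M.zero_closed M.M.zero_closed N.B.zero_closed by (auto simp: carrier_T fst_image_times)
  have cancel: "u \<oplus>\<^bsub>A\<^esub> v \<ominus>\<^bsub>A\<^esub> u = v" if "u \<in> carrier A" "v \<in> carrier A" for u v
    using that by (simp add: N.A.minus_eq N.A.a_comm[of u v] N.A.a_assoc N.A.r_neg)
  fix x y assume "x \<in> carrier T" "y \<in> carrier T"
  then show "fst (x \<otimes>\<^bsub>T\<^esub> y) \<ominus>\<^bsub>A\<^esub> fst x \<otimes>\<^bsub>A\<^esub> fst y \<in> prime_radical A"
    by (auto simp: T_simps p_radical cancel)
qed (auto simp: T_simps)

sublocale pB: hom_modulo_radical T B "\<lambda>t. snd (snd (snd t))"
proof unfold_locales
  show "(\<lambda>t. snd (snd (snd t))) ` carrier T = carrier B" by (force simp: carrier_T)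
  fix x y assume "x \<in> carrier T" "y \<in> carrier T"
  then show "snd (snd (snd (x \<otimes>\<^bsub>T\<^esub> y))) \<ominus>\<^bsub>B\<^esub> snd (snd (snd x)) \<otimes>\<^bsub>B\<^esub> snd (snd (snd y))
      \<in> prime_radical B"
    by (auto simp: T_simps q_radical N.B.minus_eq N.B.a_assoc N.B.r_neg)
qed (auto simp: T_simps)

text \<open>Multiplying \<open>s\<close> on both sides by matrices supported in the upper left
  corner leaves only its upper left entry, so the corner condition holds with
  \<open>r = fst s\<close>.\<close>

lemma corner_A:
  assumes "a \<in> prime_radical A" shows "(a, \<zero>\<^bsub>N\<^esub>, \<zero>\<^bsub>M\<^esub>, \<zero>\<^bsub>B\<^esub>) \<in> prime_radical T"
proof (rule prime_radical_corner[OF N.A.ring_axioms ring_T, of "\<lambda>a. (a, \<zero>\<^bsub>N\<^esub>, \<zero>\<^bsub>M\<^esub>, \<zero>\<^bsub>B\<^esub>)"])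
  fix s assume "s \<in> carrier T"
  then show "\<exists>r\<in>carrier A. \<forall>a\<in>carrier A. \<forall>b\<in>carrier A.
      (a, \<zero>\<^bsub>N\<^esub>, \<zero>\<^bsub>M\<^esub>, \<zero>\<^bsub>B\<^esub>) \<otimes>\<^bsub>T\<^esub> s \<otimes>\<^bsub>T\<^esub> (b, \<zero>\<^bsub>N\<^esub>, \<zero>\<^bsub>M\<^esub>, \<zero>\<^bsub>B\<^esub>) =
      (a \<otimes>\<^bsub>A\<^esub> r \<otimes>\<^bsub>A\<^esub> b, \<zero>\<^bsub>N\<^esub>, \<zero>\<^bsub>M\<^esub>, \<zero>\<^bsub>B\<^esub>)"
    by (intro bexI[of _ "fst s"]) (auto simp: T_simps action_closed)
qed (use assms in \<open>auto simp: T_simps\<close>)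

lemma corner_B:
  assumes "b \<in> prime_radical B" shows "(\<zero>\<^bsub>A\<^esub>, \<zero>\<^bsub>N\<^esub>, \<zero>\<^bsub>M\<^esub>, b) \<in> prime_radical T"
proof (rule prime_radical_corner[OF N.B.ring_axioms ring_T, of "\<lambda>b. (\<zero>\<^bsub>A\<^esub>, \<zero>\<^bsub>N\<^esub>, \<zero>\<^bsub>M\<^esub>, b)"])
  fix s assume "s \<in> carrier T"
  then show "\<exists>r\<in>carrier B. \<forall>a\<in>carrier B. \<forall>b\<in>carrier B.
      (\<zero>\<^bsub>A\<^esub>, \<zero>\<^bsub>N\<^esub>, \<zero>\<^bsub>M\<^esub>, a) \<otimes>\<^bsub>T\<^esub> s \<otimes>\<^bsub>T\<^esub> (\<zero>\<^bsub>A\<^esub>, \<zero>\<^bsub>N\<^esub>, \<zero>\<^bsub>M\<^esub>, b) =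
      (\<zero>\<^bsub>A\<^esub>, \<zero>\<^bsub>N\<^esub>, \<zero>\<^bsub>M\<^esub>, a \<otimes>\<^bsub>B\<^esub> r \<otimes>\<^bsub>B\<^esub> b)"
    by (intro bexI[of _ "snd (snd (snd s))"]) (auto simp: T_simps action_closed)
qed (use assms in \<open>auto simp: T_simps\<close>)

text \<open>
  For an off-diagonal matrix \<open>x\<close>, every product \<open>x t x\<close> is a product of a diagonal matrix in the
  radical with \<open>x\<close>, so \<open>x\<close> lies in every prime ideal.
\<close>

lemma off_diagonal_N:
  assumes n: "n \<in> carrier N" shows "(\<zero>\<^bsub>A\<^esub>, n, \<zero>\<^bsub>M\<^esub>, \<zero>\<^bsub>B\<^esub>) \<in> prime_radical T"
proof (rule T.prime_radicalI)
  let ?x = "(\<zero>\<^bsub>A\<^esub>, n, \<zero>\<^bsub>M\<^esub>, \<zero>\<^bsub>B\<^esub>)"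
  show x: "?x \<in> carrier T" using n by (simp add: carrier_T)
  fix Q assume Q: "nc_prime_ideal Q T"
  then have I: "ideal Q T" by (simp add: nc_prime_ideal_def)
  have "?x \<otimes>\<^bsub>T\<^esub> t \<otimes>\<^bsub>T\<^esub> ?x \<in> Q" if t: "t \<in> carrier T" for t
  proof -
    obtain a n' m b where t': "t = (a, n', m, b)" "a \<in> carrier A" "n' \<in> carrier N"
      "m \<in> carrier M" "b \<in> carrier B" using t by (auto simp: carrier_T)
    have "?x \<otimes>\<^bsub>T\<^esub> t \<otimes>\<^bsub>T\<^esub> ?x = (p n m, \<zero>\<^bsub>N\<^esub>, \<zero>\<^bsub>M\<^esub>, \<zero>\<^bsub>B\<^esub>) \<otimes>\<^bsub>T\<^esub> ?x"
      using n t' by (simp add: T_simps action_closed)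
    moreover have "(p n m, \<zero>\<^bsub>N\<^esub>, \<zero>\<^bsub>M\<^esub>, \<zero>\<^bsub>B\<^esub>) \<in> Q"
      using T.prime_radicalD[OF corner_A[OF p_radical] Q] n t' by simp
    ultimately show ?thesis using ideal.I_r_closed[OF I _ x] by simp
  qed
  then show "?x \<in> Q" using T.nc_prime_ideal_memD[OF Q x x] by blast
qed

lemma off_diagonal_M:
  assumes m: "m \<in> carrier M" shows "(\<zero>\<^bsub>A\<^esub>, \<zero>\<^bsub>N\<^esub>, m, \<zero>\<^bsub>B\<^esub>) \<in> prime_radical T"
proof (rule T.prime_radicalI)
  let ?x = "(\<zero>\<^bsub>A\<^esub>, \<zero>\<^bsub>N\<^esub>, m, \<zero>\<^bsub>B\<^esub>)"
  show x: "?x \<in> carrier T" using m by (simp add: carrier_T)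
  fix Q assume Q: "nc_prime_ideal Q T"
  then have I: "ideal Q T" by (simp add: nc_prime_ideal_def)
  have "?x \<otimes>\<^bsub>T\<^esub> t \<otimes>\<^bsub>T\<^esub> ?x \<in> Q" if t: "t \<in> carrier T" for t
  proof -
    obtain a n m' b where t': "t = (a, n, m', b)" "a \<in> carrier A" "n \<in> carrier N"
      "m' \<in> carrier M" "b \<in> carrier B" using t by (auto simp: carrier_T)
    have "?x \<otimes>\<^bsub>T\<^esub> t \<otimes>\<^bsub>T\<^esub> ?x = (\<zero>\<^bsub>A\<^esub>, \<zero>\<^bsub>N\<^esub>, \<zero>\<^bsub>M\<^esub>, q m n) \<otimes>\<^bsub>T\<^esub> ?x"
      using m t' by (simp add: T_simps action_closed)
    moreover have "(\<zero>\<^bsub>A\<^esub>, \<zero>\<^bsub>N\<^esub>, \<zero>\<^bsub>M\<^esub>, q m n) \<in> Q"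
      using T.prime_radicalD[OF corner_B[OF q_radical] Q] m t' by simp
    ultimately show ?thesis using ideal.I_r_closed[OF I _ x] by simp
  qed
  then show "?x \<in> Q" using T.nc_prime_ideal_memD[OF Q x x] by blast
qed

lemma prime_radical_T:
  assumes "a \<in> prime_radical A" "n \<in> carrier N" "m \<in> carrier M" "b \<in> prime_radical B"
  shows "(a, n, m, b) \<in> prime_radical T"
proof -
  have c: "a \<in> carrier A" "b \<in> carrier B" using assms by (auto simp: prime_radical_def)
  have "(a, n, m, b) = ((a, \<zero>\<^bsub>N\<^esub>, \<zero>\<^bsub>M\<^esub>, \<zero>\<^bsub>B\<^esub>) \<oplus>\<^bsub>T\<^esub> (\<zero>\<^bsub>A\<^esub>, n, \<zero>\<^bsub>M\<^esub>, \<zero>\<^bsub>B\<^esub>)) \<oplus>\<^bsub>T\<^esub>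
      ((\<zero>\<^bsub>A\<^esub>, \<zero>\<^bsub>N\<^esub>, m, \<zero>\<^bsub>B\<^esub>) \<oplus>\<^bsub>T\<^esub> (\<zero>\<^bsub>A\<^esub>, \<zero>\<^bsub>N\<^esub>, \<zero>\<^bsub>M\<^esub>, b))"
    using c assms by (simp add: add_T)
  also have "\<dots> \<in> prime_radical T"
    using assms
    by (intro T.ideal_plus_closed[OF T.prime_radical_ideal] corner_A corner_B off_diagonal_N off_diagonal_M)
  finally show ?thesis .
qed

theorem strongly_periodic_T_iff:
  "strongly_periodic A \<and> strongly_periodic B \<longleftrightarrow> strongly_periodic T"
proof
  assume "strongly_periodic T"
  then show "strongly_periodic A \<and> strongly_periodic B"
    using pA.strongly_periodic_image pB.strongly_periodic_image by blast
next
  assume AB: "strongly_periodic A \<and> strongly_periodic B"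
  show "strongly_periodic T" unfolding T.strongly_periodic_iff
  proof
    fix t assume t: "t \<in> carrier T"
    then obtain a n m b where t': "t = (a, n, m, b)" "a \<in> carrier A" "n \<in> carrier N"
      "m \<in> carrier M" "b \<in> carrier B" by (auto simp: carrier_T)
    obtain i j :: nat where i: "i \<ge> 2" "a \<ominus>\<^bsub>A\<^esub> a [^]\<^bsub>A\<^esub> i \<in> prime_radical A"
      and j: "j \<ge> 2" "b \<ominus>\<^bsub>B\<^esub> b [^]\<^bsub>B\<^esub> j \<in> prime_radical B"
      using AB t' unfolding N.A.strongly_periodic_iff N.B.strongly_periodic_iff by meson
    obtain i' where i': "i = Suc i'" "0 < i'" using i(1) by (cases i) auto
    obtain j' where j': "j = Suc j'" "0 < j'" using j(1) by (cases j) auto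
    \<comment> \<open>This exponent is 1 modulo both \<open>i'\<close> and \<open>j'\<close>, so it
      serves both diagonal entries at once.\<close>
    define k where "k = Suc (i' * j')"
    have "a \<ominus>\<^bsub>A\<^esub> a [^]\<^bsub>A\<^esub> k \<in> prime_radical A" "b \<ominus>\<^bsub>B\<^esub> b [^]\<^bsub>B\<^esub> k \<in> prime_radical B"
      using N.A.ideal_cong_pow_period[OF N.A.prime_radical_ideal t'(2), of i' j'] i i'
        N.B.ideal_cong_pow_period[OF N.B.prime_radical_ideal t'(5), of j' i'] j j'
      by (simp_all add: k_def mult.commute)
    then have rad: "fst (t \<ominus>\<^bsub>T\<^esub> t [^]\<^bsub>T\<^esub> k) \<in> prime_radical A"
      "snd (snd (snd (t \<ominus>\<^bsub>T\<^esub> t [^]\<^bsub>T\<^esub> k))) \<in> prime_radical B"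
      using pA.power_cong[OF t, of k] pB.power_cong[OF t, of k] by (auto simp: t')
    have "t \<ominus>\<^bsub>T\<^esub> t [^]\<^bsub>T\<^esub> k \<in> carrier T" using t by simp
    \<comment> \<open>Radical diagonal entries suffice; the off-diagonal entries of the difference
      never have to be computed.\<close>
    then have "t \<ominus>\<^bsub>T\<^esub> t [^]\<^bsub>T\<^esub> k \<in> prime_radical T"
      using rad by (cases "t \<ominus>\<^bsub>T\<^esub> t [^]\<^bsub>T\<^esub> k") (auto simp: carrier_T intro: prime_radical_T)
    moreover have "k \<ge> 2" using i' j' by (simp add: k_def Suc_le_eq)
    ultimately show "\<exists>n::nat. n \<ge> 2 \<and> t \<ominus>\<^bsub>T\<^esub> t [^]\<^bsub>T\<^esub> n \<in> prime_radical T" by blast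
  qed
qed

end

theorem theorem3p7:
  fixes A :: "('a, 'r) ring_scheme" and B :: "('b, 's) ring_scheme"
    and M :: "('b, 'a, 'm, 'e) bimodule_scheme" and N :: "('a, 'b, 'n, 'f) bimodule_scheme"
    and \<psi> :: "('n \<times> 'm \<Rightarrow>\<^sub>0 int) set \<Rightarrow> 'a" and \<phi> :: "('m \<times> 'n \<Rightarrow>\<^sub>0 int) set \<Rightarrow> 'b"
  assumes "ring A" and "ring B"
    and "morita_context A B M N \<psi> \<phi>"
    and "nilpotent_ideal (\<psi> ` carrier (tensor_bimodule B N M)) A"
    and "nilpotent_ideal (\<phi> ` carrier (tensor_bimodule A M N)) B"
  shows "strongly_periodic A \<and> strongly_periodic B \<longleftrightarrow>
         strongly_periodic (morita_ring A B M N \<psi> \<phi>)"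
proof -
  interpret C: morita_context A B M N \<psi> \<phi> by fact
  \<comment> \<open>Pure tensors lie in the tensor products, so the pairing values lie in the
    nilpotent images, which are contained in the prime radicals.\<close>
  interpret C: radical_morita_context A B M N \<psi> \<phi>
  proof unfold_locales
    show "C.p n m \<in> prime_radical A" if "n \<in> carrier N" "m \<in> carrier M" for n m
      using C.N.A.nilpotent_ideal_subset_prime_radical[OF assms(4)]
        C.NM.pure_tensor_closed[OF that] by blast
    show "C.q m n \<in> prime_radical B" if "m \<in> carrier M" "n \<in> carrier N" for m n
      using C.N.B.nilpotent_ideal_subset_prime_radical[OF assms(5)]
        C.MN.pure_tensor_closed[OF that] by blast
  qed
  show ?thesis by (rule C.strongly_periodic_T_iff)
qed

end
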